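(* Let $S$ be a $\mathbb{Q}$-algebra, $\varphi: S \to R$ a ring morphism, $W \in S$ (also written $W$ for $\varphi(W)$), and $(X,d_X)$ a finite rank matrix factorisation of $W$ over $R$. Let $\mathbf{t} = \{t_1,\ldots,t_n\}$ be a quasi-regular sequence in $R$ such that $R/\mathbf{t}R$ is a finitely generated projective $S$-module, and suppose each $t_j \cdot 1_X$ is null-homotopic, with odd $R$-linear maps $\lambda_j$ on $X$ satisfying $\lambda_j d_X + d_X \lambda_j = t_j \cdot 1_X$. Assume that $R$, viewed as an $S[\mathbf{t}]$-module, admits a standard flat $S$-linear connection. Then there are morphisms in the homotopy category $\mathrm{hf}(S,W)$ \[ \psi: X/\mathbf{t}X \to \varphi_*(X)[n], \qquad \vartheta: \varphi_*(X)[n] \to X/\mathbf{t}X \] with $\psi \circ \vartheta = 1$, and the idempotent $e = \vartheta \circ \psi$ is given by \[ e = \frac{1}{n!} (-1)^{\binom{n+1}{2}} \lambda_1 \cdots \lambda_n \circ \mathrm{At}_{S[\mathbf{t}]/S}(X)^n, \] regarded as an $S$-linear endomorphism of $X/\mathbf{t}X$.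
   Context: All rings are commutative. A linear factorisation of $W \in R$ over $R$ is a $\mathbb{Z}/2$-graded $R$-module $X = X^0 \oplus X^1$ with an odd $R$-linear map $d_X$ satisfying $d_X^2 = W\cdot 1_X$; it is a matrix factorisation if $X^0,X^1$ are free, and finite rank if moreover finitely generated. Morphisms are even maps commuting with the differentials, and two morphisms are homotopic if they differ by $d_Y h + h d_X$ for an odd $h$. $\mathrm{hf}(R,W)$ is the homotopy category of linear factorisations. $X[1]$ is $X$ with the grading shifted by one and differential $-d_X$. For a ring morphism $\varphi: S\to R$ and $W\in S$, $\varphi_*(X)$ is $X$ viewed as an $S$-module via $\varphi$, a linear factorisation of $W$ over $S$. $X/\mathbf{t}X = X \otimes_R R/\mathbf{t}R$ with differential induced by $d_X$; it is a linear factorisation of $W$ over $S$. $S[\mathbf{t}] = S[t_1,\ldots,t_n]$ is the polynomial ring in formal variables, and $R$ is an $S[\mathbf{t}]$-algebra via $t_i \mapsto t_i$. An $S$-linear connection on an $S[\mathbf{t}]$-module $M$ is an $S$-linear map $\nabla^0: M \to M \otimes_{S[\mathbf{t}]} \Omega^1_{S[\mathbf{t}]/S}$ satisfying the Leibniz rule $\nabla^0(am) = a\nabla^0(m) + m \otimes \mathrm{d}a$. For $R$, write $\nabla^0(r) = \sum_j \partial_j(r) \otimes \mathrm{d}t_j$; it is flat if its extension to $R\otimes_{S[\mathbf{t}]}\Omega_{S[\mathbf{t}]/S}$ squares to zero (equivalently the $\partial_j$ commute). It is standard if it is flat and, writing $\delta\nabla^0(r) = \sum_j t_j \partial_j(r)$,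 for every integer $p>0$ the map $r \mapsto p r + \sum_j t_j\partial_j(r)$ is a bijection of $R$ mapping $\mathbf{t}R$ onto $\mathbf{t}R$, and the image of $r \mapsto \sum_j t_j\partial_j(r)$ is $\mathbf{t}R$. Atiyah class: choose an $S$-linear connection $\nabla_X$ on $X$ as an $S[\mathbf{t}]$-module (e.g. $\nabla_X(r\xi_i) = \xi_i \otimes \nabla^0(r)$ for a homogeneous $R$-basis $\{\xi_i\}$). Giving $X\otimes_{S[\mathbf{t}]}\Omega^1_{S[\mathbf{t}]/S}$ the differential $d_X\otimes 1$, the commutator $\mathrm{At}_{S[\mathbf{t}]/S}(X) = [d_X,\nabla_X]$ is an $S[\mathbf{t}]$-linear morphism $X \to X \otimes \Omega^1_{S[\mathbf{t}]/S}[1]$, independent of $\nabla_X$ up to homotopy. Its $n$-fold iterate (composing via $\Omega^i\otimes\Omega^j\to\Omega^{i+j}$) is $\mathrm{At}_{S[\mathbf{t}]/S}(X)^n: X \to X\otimes\Omega^n_{S[\mathbf{t}]/S}[n] \cong X[n]$, trivialising $\Omega^n$ via $\mathrm{d}t_1\wedge\cdots\wedge\mathrm{d}t_n$. Since the $\lambda_j$ and $\mathrm{At}^n$ are $S[\mathbf{t}]$-linear they induce $S$-linear maps on $X/\mathbf{t}X$. *)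

theory Defs
  imports "HOL-Combinatorics.Permutations" "HOL-Library.Function_Algebras"
begin

definition ring_morphism :: "('s::comm_ring_1 \<Rightarrow> 'r::comm_ring_1) \<Rightarrow> bool" where
  "ring_morphism phi \<longleftrightarrow> phi 1 = 1 \<and> (\<forall>a b. phi (a + b) = phi a + phi b)
     \<and> (\<forall>a b. phi (a * b) = phi a * phi b)"

definition Q_algebra :: "'s::comm_ring_1 itself \<Rightarrow> bool" where
  "Q_algebra _ \<longleftrightarrow> (\<forall>k::nat. k > 0 \<longrightarrow> (\<exists>u::'s. of_nat k * u = 1))"

definition nat_inv :: "nat \<Rightarrow> 's::comm_ring_1" where
  "nat_inv k = (THE u. of_nat k * u = 1)"

definition tideal :: "(nat \<Rightarrow> 'r::comm_ring_1) \<Rightarrow> nat \<Rightarrow> 'r set" where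
  "tideal t n = {x. \<exists>c. x = (\<Sum>j<n. t j * c j)}"

definition expo :: "nat \<Rightarrow> nat \<Rightarrow> (nat \<Rightarrow> nat) set" where
  "expo n k = {\<alpha>. (\<forall>j\<ge>n. \<alpha> j = 0) \<and> (\<Sum>j<n. \<alpha> j) = k}"

definition tmono :: "(nat \<Rightarrow> 'r::comm_ring_1) \<Rightarrow> nat \<Rightarrow> (nat \<Rightarrow> nat) \<Rightarrow> 'r" where
  "tmono t n \<alpha> = (\<Prod>j<n. t j ^ \<alpha> j)"

definition tideal_pow :: "(nat \<Rightarrow> 'r::comm_ring_1) \<Rightarrow> nat \<Rightarrow> nat \<Rightarrow> 'r set" where
  "tideal_pow t n k = {x. \<exists>c. x = (\<Sum>\<alpha>\<in>expo n k. c \<alpha> * tmono t n \<alpha>)}"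

text \<open>Quasi-regular sequence: the canonical map (R/I)[T_1..T_n] \<rightarrow> gr_I R (I = tR),
  T_j \<mapsto> class of t_j, is an isomorphism. It is always surjective, so this means: it is
  injective in each degree k.\<close>
definition quasi_regular :: "(nat \<Rightarrow> 'r::comm_ring_1) \<Rightarrow> nat \<Rightarrow> bool" where
  "quasi_regular t n \<longleftrightarrow> (\<forall>k c. (\<Sum>\<alpha>\<in>expo n k. c \<alpha> * tmono t n \<alpha>) \<in> tideal_pow t n (Suc k)
      \<longrightarrow> (\<forall>\<alpha>\<in>expo n k. c \<alpha> \<in> tideal t n))"

text \<open>R/tR is a finitely generated projective S-module (S acting through phi):
  it is a retract of a finite free module S^N (vectors supported on {..<N}).
  p : R \<rightarrow> S^N is an S-linear map killing tR; s : S^N \<rightarrow> R is S-linear;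
  s \<circ> p = id on R/tR.\<close>
definition fg_projective_quotient ::
  "('s::comm_ring_1 \<Rightarrow> 'r::comm_ring_1) \<Rightarrow> (nat \<Rightarrow> 'r) \<Rightarrow> nat \<Rightarrow> bool" where
  "fg_projective_quotient phi t n \<longleftrightarrow>
    (\<exists>(N::nat) (p :: 'r \<Rightarrow> nat \<Rightarrow> 's) (s :: (nat \<Rightarrow> 's) \<Rightarrow> 'r).
       (\<forall>x. \<forall>i\<ge>N. p x i = 0)
     \<and> (\<forall>x y. p (x + y) = p x + p y) \<and> (\<forall>a x. p (phi a * x) = (\<lambda>i. a * p x i))
     \<and> (\<forall>x\<in>tideal t n. p x = 0)
     \<and> (\<forall>u v. s (u + v) = s u + s v) \<and> (\<forall>a u. s (\<lambda>i. a * u i) = phi a * s u)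
     \<and> (\<forall>x. s (p x) - x \<in> tideal t n))"

text \<open>Omega^1_{S[t]/S} is free on dt_0..dt_(n-1), so an S-linear connection on R is given by
  its components del j (nabla(r) = sum_j del j r \<otimes> dt_j). S-linearity plus the Leibniz
  rule for the generators t_k of S[t] (which is equivalent to the Leibniz rule for all of S[t]).\<close>
definition connection :: "('s::comm_ring_1 \<Rightarrow> 'r::comm_ring_1) \<Rightarrow> (nat \<Rightarrow> 'r) \<Rightarrow> nat
    \<Rightarrow> (nat \<Rightarrow> 'r \<Rightarrow> 'r) \<Rightarrow> bool" where
  "connection phi t n del \<longleftrightarrow> (\<forall>j<n.
      (\<forall>x y. del j (x + y) = del j x + del j y)
    \<and> (\<forall>a x. del j (phi a * x) = phi a * del j x)
    \<and> (\<forall>k<n. \<forall>x. del j (t k * x) = t k * del j x + (if j = k then x else 0)))"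

definition flat_connection :: "nat \<Rightarrow> (nat \<Rightarrow> 'r \<Rightarrow> 'r) \<Rightarrow> bool" where
  "flat_connection n del \<longleftrightarrow> (\<forall>j<n. \<forall>k<n. \<forall>x. del j (del k x) = del k (del j x))"

definition euler_op :: "(nat \<Rightarrow> 'r::comm_ring_1) \<Rightarrow> nat \<Rightarrow> (nat \<Rightarrow> 'r \<Rightarrow> 'r) \<Rightarrow> 'r \<Rightarrow> 'r" where
  "euler_op t n del r = (\<Sum>j<n. t j * del j r)"

definition standard_connection :: "('s::comm_ring_1 \<Rightarrow> 'r::comm_ring_1) \<Rightarrow> (nat \<Rightarrow> 'r) \<Rightarrow> nat
    \<Rightarrow> (nat \<Rightarrow> 'r \<Rightarrow> 'r) \<Rightarrow> bool" where
  "standard_connection phi t n del \<longleftrightarrow> connection phi t n del \<and> flat_connection n del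
    \<and> (\<forall>p::nat. p > 0 \<longrightarrow> bij (\<lambda>r. of_nat p * r + euler_op t n del r)
          \<and> (\<lambda>r. of_nat p * r + euler_op t n del r) ` tideal t n = tideal t n)
    \<and> range (euler_op t n del) = tideal t n"

definition vecs :: "'i set \<Rightarrow> ('i \<Rightarrow> 'r::zero) set" where
  "vecs I = {x. \<forall>i. i \<notin> I \<longrightarrow> x i = 0}"

definition mat_app :: "'i set \<Rightarrow> ('i \<Rightarrow> 'i \<Rightarrow> 'r::comm_ring_1) \<Rightarrow> ('i \<Rightarrow> 'r) \<Rightarrow> 'i \<Rightarrow> 'r" where
  "mat_app I M x = (\<lambda>i. if i \<in> I then (\<Sum>k\<in>I. M i k * x k) else 0)"

text \<open>An odd matrix w.r.t. the parity par (par i = True: basis vector i is odd).\<close>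
definition odd_mat :: "'i set \<Rightarrow> ('i \<Rightarrow> bool) \<Rightarrow> ('i \<Rightarrow> 'i \<Rightarrow> 'r::zero) \<Rightarrow> bool" where
  "odd_mat I par M \<longleftrightarrow> (\<forall>i\<in>I. \<forall>k\<in>I. par i = par k \<longrightarrow> M i k = 0)"

definition matrix_factorisation :: "'i set \<Rightarrow> ('i \<Rightarrow> bool) \<Rightarrow> ('i \<Rightarrow> 'i \<Rightarrow> 'r::comm_ring_1) \<Rightarrow> 'r \<Rightarrow> bool" where
  "matrix_factorisation I par D w \<longleftrightarrow> finite I \<and> odd_mat I par D
     \<and> (\<forall>i\<in>I. \<forall>l\<in>I. (\<Sum>k\<in>I. D i k * D k l) = (if i = l then w else 0))"

definition par_proj :: "('i \<Rightarrow> bool) \<Rightarrow> bool \<Rightarrow> ('i \<Rightarrow> 'r::zero) \<Rightarrow> 'i \<Rightarrow> 'r" where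
  "par_proj par b x = (\<lambda>i. if par i = b then x i else 0)"

text \<open>A linear factorisation over S presented as a quotient (vecs I) / N, with S acting via phi,
  grading given by par and differential induced by the matrix D. Maps between two such
  objects are represented by functions on representatives; all identities hold modulo the
  target submodule NB. The flag ev says whether the map is even (True) or odd (False).\<close>
definition lf_map :: "('s::comm_ring_1 \<Rightarrow> 'r::comm_ring_1) \<Rightarrow> 'i set \<Rightarrow> bool
    \<Rightarrow> ('i \<Rightarrow> 'r) set \<Rightarrow> ('i \<Rightarrow> bool)
    \<Rightarrow> ('i \<Rightarrow> 'r) set \<Rightarrow> ('i \<Rightarrow> bool) \<Rightarrow> (('i \<Rightarrow> 'r) \<Rightarrow> ('i \<Rightarrow> 'r)) \<Rightarrow> bool" where
  "lf_map phi I ev NA pA NB pB f \<longleftrightarrow>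
      (\<forall>x\<in>vecs I. f x \<in> vecs I)
    \<and> (\<forall>x\<in>vecs I. \<forall>y\<in>vecs I. x - y \<in> NA \<longrightarrow> f x - f y \<in> NB)
    \<and> (\<forall>x\<in>vecs I. \<forall>y\<in>vecs I. f (x + y) - (f x + f y) \<in> NB)
    \<and> (\<forall>a. \<forall>x\<in>vecs I. f (\<lambda>i. phi a * x i) - (\<lambda>i. phi a * f x i) \<in> NB)
    \<and> (\<forall>b. \<forall>x\<in>vecs I. f (par_proj pA b x) - par_proj pB (if ev then b else \<not> b) (f x) \<in> NB)"

definition lf_morphism :: "('s::comm_ring_1 \<Rightarrow> 'r::comm_ring_1) \<Rightarrow> 'i set
    \<Rightarrow> ('i \<Rightarrow> 'r) set \<Rightarrow> ('i \<Rightarrow> bool) \<Rightarrow> ('i \<Rightarrow> 'i \<Rightarrow> 'r)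
    \<Rightarrow> ('i \<Rightarrow> 'r) set \<Rightarrow> ('i \<Rightarrow> bool) \<Rightarrow> ('i \<Rightarrow> 'i \<Rightarrow> 'r)
    \<Rightarrow> (('i \<Rightarrow> 'r) \<Rightarrow> ('i \<Rightarrow> 'r)) \<Rightarrow> bool" where
  "lf_morphism phi I NA pA DA NB pB DB f \<longleftrightarrow> lf_map phi I True NA pA NB pB f
    \<and> (\<forall>x\<in>vecs I. f (mat_app I DA x) - mat_app I DB (f x) \<in> NB)"

definition lf_homotopic :: "('s::comm_ring_1 \<Rightarrow> 'r::comm_ring_1) \<Rightarrow> 'i set
    \<Rightarrow> ('i \<Rightarrow> 'r) set \<Rightarrow> ('i \<Rightarrow> bool) \<Rightarrow> ('i \<Rightarrow> 'i \<Rightarrow> 'r)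
    \<Rightarrow> ('i \<Rightarrow> 'r) set \<Rightarrow> ('i \<Rightarrow> bool) \<Rightarrow> ('i \<Rightarrow> 'i \<Rightarrow> 'r)
    \<Rightarrow> (('i \<Rightarrow> 'r) \<Rightarrow> ('i \<Rightarrow> 'r)) \<Rightarrow> (('i \<Rightarrow> 'r) \<Rightarrow> ('i \<Rightarrow> 'r)) \<Rightarrow> bool" where
  "lf_homotopic phi I NA pA DA NB pB DB f g \<longleftrightarrow>
    (\<exists>h. lf_map phi I False NA pA NB pB h
      \<and> (\<forall>x\<in>vecs I. f x - g x - (mat_app I DB (h x) + h (mat_app I DA x)) \<in> NB))"

definition tvecs :: "'i set \<Rightarrow> (nat \<Rightarrow> 'r::comm_ring_1) \<Rightarrow> nat \<Rightarrow> ('i \<Rightarrow> 'r) set" where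
  "tvecs I t n = {x \<in> vecs I. \<forall>i. x i \<in> tideal t n}"

definition shift_par :: "nat \<Rightarrow> ('i \<Rightarrow> bool) \<Rightarrow> 'i \<Rightarrow> bool" where
  "shift_par n par = (\<lambda>i. par i \<noteq> odd n)"

definition shift_mat :: "nat \<Rightarrow> ('i \<Rightarrow> 'i \<Rightarrow> 'r::comm_ring_1) \<Rightarrow> 'i \<Rightarrow> 'i \<Rightarrow> 'r" where
  "shift_mat n D = (\<lambda>i k. (-1) ^ n * D i k)"

text \<open>Component j of At(X) = [d_X, nabla_X] for the connection nabla_X(r xi_i) = xi_i \<otimes> nabla^0(r):
  At(X)(x) = sum_j At_j(x) \<otimes> dt_j with At_j = d_X del_j - del_j d_X.\<close>
definition atiyah_comp :: "'i set \<Rightarrow> ('i \<Rightarrow> 'i \<Rightarrow> 'r::comm_ring_1) \<Rightarrow> (nat \<Rightarrow> 'r \<Rightarrow> 'r) \<Rightarrow> nat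
    \<Rightarrow> ('i \<Rightarrow> 'r) \<Rightarrow> 'i \<Rightarrow> 'r" where
  "atiyah_comp I D del j x = mat_app I D (\<lambda>i. del j (x i)) - (\<lambda>i. del j (mat_app I D x i))"

definition comp_list :: "('a \<Rightarrow> 'a) list \<Rightarrow> 'a \<Rightarrow> 'a" where
  "comp_list fs = foldr (\<circ>) fs id"

text \<open>At(X)^n : X \<rightarrow> X \<otimes> Omega^n \<cong> X[n] (trivialised by dt_1\<and>...\<and>dt_n):
  sum over j_1..j_n of At_{j_1} \<circ> ... \<circ> At_{j_n} \<otimes> dt_{j_1}\<and>...\<and>dt_{j_n}.\<close>
definition atiyah_pow :: "'i set \<Rightarrow> ('i \<Rightarrow> 'i \<Rightarrow> 'r::comm_ring_1) \<Rightarrow> (nat \<Rightarrow> 'r \<Rightarrow> 'r) \<Rightarrow> nat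
    \<Rightarrow> ('i \<Rightarrow> 'r) \<Rightarrow> 'i \<Rightarrow> 'r" where
  "atiyah_pow I D del n x = (\<Sum>\<sigma>\<in>{\<sigma>. \<sigma> permutes {..<n}}.
      (\<lambda>i. of_int (sign \<sigma>) * comp_list (map (\<lambda>k. atiyah_comp I D del (\<sigma> k)) [0..<n]) x i))"

definition e_map :: "('s::comm_ring_1 \<Rightarrow> 'r::comm_ring_1) \<Rightarrow> 'i set \<Rightarrow> ('i \<Rightarrow> 'i \<Rightarrow> 'r)
    \<Rightarrow> (nat \<Rightarrow> 'i \<Rightarrow> 'i \<Rightarrow> 'r) \<Rightarrow> (nat \<Rightarrow> 'r \<Rightarrow> 'r) \<Rightarrow> nat \<Rightarrow> ('i \<Rightarrow> 'r) \<Rightarrow> 'i \<Rightarrow> 'r" where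
  "e_map phi I D L del n x = (\<lambda>i. phi (nat_inv (fact n)) * (-1) ^ ((n + 1) choose 2)
      * comp_list (map (\<lambda>j. mat_app I (L j)) [0..<n]) (atiyah_pow I D del n x) i)"

end

theory Submission
  imports Defs
begin

text \<open>
  Let \<open>\<Omega>\<close> be the exterior algebra on \<open>dt\<^sub>1, \<dots>, dt\<^sub>n\<close>, with Koszul differential \<open>\<delta>\<close> (contraction with
  the \<open>t\<^sub>j\<close>). Since \<open>\<delta>\<nabla> + \<nabla>\<delta>\<close> is the form degree plus the Euler operator, the standard connection makes
  \<open>H = (\<delta>\<nabla> + \<nabla>\<delta>)\<inverse>\<nabla>\<close> a contracting homotopy of the Koszul complex onto \<open>R/tR\<close>. Perturbing \<open>\<delta>\<close> by
  \<open>d\<^sub>X\<close> yields an \<open>S\<close>-linear homotopy equivalence between \<open>X/tX\<close> and \<open>(\<Omega> \<otimes> X, d\<^sub>X + \<delta>)\<close>. Because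
  the \<open>t\<^sub>j\<close> are null-homotopic, conjugation with the product of the \<open>1 - \<lambda>\<^sub>j dt\<^sub>j\<^sup>*\<close> removes \<open>\<delta>\<close>, so
  the top forms exhibit \<open>X[n]\<close> as a direct summand of \<open>\<Omega> \<otimes> X\<close>. Composing gives \<open>\<psi>\<close> and \<open>\<theta>\<close>.
  Modulo \<open>t\<close> the Euler operator vanishes, so in degree \<open>p\<close> the operator \<open>-H d\<^sub>X\<close> becomes \<open>1/p\<close> times
  the Atiyah class, and the \<open>n\<close> perturbation steps from degree 0 to degree n produce \<open>At\<^sup>n / n!\<close>.
\<close>

section \<open>The ring of additive endomorphisms\<close>

definition additive_map :: "('a::ab_group_add \<Rightarrow> 'a) \<Rightarrow> bool" where
  "additive_map f \<longleftrightarrow> (\<forall>x y. f (x + y) = f x + f y)"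

text \<open>Additive maps become a \<open>ring_1\<close>, so operator identities are ring algebra
  and the perturbation argument can be run in an abstract ring.\<close>

typedef (overloaded) 'a endo = "{f :: 'a::ab_group_add \<Rightarrow> 'a. additive_map f}"
  morphisms app Abs_endo
  by (rule exI[of _ "\<lambda>_. 0"]) (simp add: additive_map_def)

definition endo :: "('a::ab_group_add \<Rightarrow> 'a) \<Rightarrow> 'a endo" where
  "endo f = Abs_endo (if additive_map f then f else (\<lambda>_. 0))"

lemma app_endo: "additive_map f \<Longrightarrow> app (endo f) = f"
  by (simp add: endo_def Abs_endo_inverse)

lemma additive_app: "additive_map (app f)"
  using app by blast

lemma app_add [simp]: "app f (x + y) = app f x + app f y"
  using additive_app[of f] by (simp add: additive_map_def)

lemma app_zero [simp]: "app f 0 = 0"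
  using app_add[of f 0 0] by simp

lemma app_minus [simp]: "app f (- x) = - app f x"
  using app_add[of f x "- x"] by (simp add: eq_neg_iff_add_eq_0 add.commute)

lemma app_diff [simp]: "app f (x - y) = app f x - app f y"
  using app_add[of f x "- y"] by simp

lemma app_sum: "app f (sum g S) = (\<Sum>k\<in>S. app f (g k))"
  by (induction S rule: infinite_finite_induct) auto

lemma endo_eqI: "(\<And>x. app f x = app g x) \<Longrightarrow> f = g"
  by (metis app_inject ext)

instantiation endo :: ("{ab_group_add, zero_neq_one}") ring_1
begin

definition "0 = endo (\<lambda>_. 0)"
definition "1 = endo (\<lambda>x. x)"
definition "f + g = endo (\<lambda>x. app f x + app g x)"
definition "f - g = endo (\<lambda>x. app f x - app g x)"
definition "- f = endo (\<lambda>x. - app f x)"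
definition "f * g = endo (\<lambda>x. app f (app g x))"

lemma app_arith [simp]:
  "app 0 x = 0" "app 1 x = x" "app (f + g) x = app f x + app g x"
  "app (f - g) x = app f x - app g x" "app (- f) x = - app f x" "app (f * g) x = app f (app g x)"
  unfolding zero_endo_def one_endo_def plus_endo_def minus_endo_def uminus_endo_def times_endo_def
  by (subst app_endo; simp add: additive_map_def algebra_simps)+

instance
proof
  have "app 0 (1::'a) \<noteq> app 1 (1::'a)"
    by simp
  then show "(0::'a endo) \<noteq> 1"
    by metis
qed (rule endo_eqI; simp add: algebra_simps)+

end

lemma app_sum_left: "app (sum f S) x = (\<Sum>k\<in>S. app (f k) x)"
  by (induction S rule: infinite_finite_induct) auto

lemma app_prod_list: "app (prod_list (map f ks)) x = comp_list (map (\<lambda>k. app (f k)) ks) x"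
  by (induction ks) (auto simp: comp_list_def)

section \<open>Anticommuting families\<close>

text \<open>Lets a relation between adjacent factors rewrite a right-nested product with tail
  \<open>x\<close>.\<close>

lemma mult_left_assoc: "a * b = c \<Longrightarrow> a * (b * x) = c * x" for a :: "'a::semigroup_mult"
  by (simp flip: mult.assoc)

lemma prod_list_anticommute:
  fixes c :: "nat \<Rightarrow> 'a::ring_1"
  assumes "\<And>i j. c i * c j = - (c j * c i)"
  shows "prod_list (map c js) * c j = (- 1) ^ length js * (c j * prod_list (map c js))"
proof (induction js)
  case (Cons i js)
  then show ?case
    using assms[of i j] by (cases "even (length js)") (simp_all add: mult.assoc flip: mult.assoc[of "c i" "c j"])
qed simp

text \<open>Anticommutation brings two equal factors side by side, where \<open>sq\<close>
  applies.\<close>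

lemma prod_list_anticommute_not_distinct:
  fixes c :: "nat \<Rightarrow> 'a::ring_1"
  assumes anti: "\<And>i j. c i * c j = - (c j * c i)" and sq: "\<And>i. c i * c i = 0"
    and "\<not> distinct js"
  shows "prod_list (map c js) = 0"
proof -
  obtain xs ys zs y where js: "js = xs @ [y] @ ys @ [y] @ zs"
    using not_distinct_decomp[OF \<open>\<not> distinct js\<close>] by blast
  have "c y * (prod_list (map c ys) * (c y * x)) = 0" for x
    by (cases "even (length ys)")
      (simp_all add: mult.assoc mult_left_assoc[OF sq] mult_left_assoc[OF prod_list_anticommute[of c, OF anti]])
  then show ?thesis
    by (simp add: js)
qed

text \<open>Pulling the second letter through \<open>ys\<close> costs the same sign in both orders,
  so a single exchange of neighbours decides.\<close>

lemma prod_list_anticommute_swap: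
  fixes c :: "nat \<Rightarrow> 'a::ring_1"
  assumes anti: "\<And>i j. c i * c j = - (c j * c i)"
  shows "prod_list (map c (xs @ [a] @ ys @ [b] @ zs)) = - prod_list (map c (xs @ [b] @ ys @ [a] @ zs))"
proof -
  have "c i * (prod_list (map c ys) * (c j * x)) = (- 1) ^ length ys * (c i * (c j * (prod_list (map c ys) * x)))"
    for i j x
    by (cases "even (length ys)")
      (simp_all add: mult.assoc mult_left_assoc[OF prod_list_anticommute[of c, OF anti]])
  then show ?thesis
    by (simp add: mult_left_assoc[OF anti[of a b]] mult.assoc)
qed

lemma prod_list_anticommute_permutes:
  fixes c :: "nat \<Rightarrow> 'a::ring_1"
  assumes anti: "\<And>i j. c i * c j = - (c j * c i)" and "\<sigma> permutes {..<n}"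
  shows "prod_list (map c (map \<sigma> [0..<n])) = of_int (sign \<sigma>) * prod_list (map c [0..<n])"
  using assms(2) finite_lessThan
proof (induction rule: permutes_induct)
  case (swap a b p)
  let ?js = "map p [0..<n]" and ?t = "Transposition.transpose a b"
  have dist: "distinct ?js" and set: "set ?js = {..<n}"
    using permutes_inj_on[OF swap.hyps(4)] permutes_image[OF swap.hyps(4)]
    by (simp_all add: distinct_map atLeast0LessThan)
  \<comment> \<open>In a distinct list the transposition exchanges the positions of \<open>a\<close>
    and \<open>b\<close> only; \<open>u\<close>, \<open>v\<close> are these two in order of
    occurrence.\<close>
  have step: "prod_list (map c (map ?t js)) = - prod_list (map c js)"
    if "js = xs @ [u] @ ys @ [v] @ zs" "distinct js" "{u, v} = {a, b}" for js xs ys zs u v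
  proof -
    have fixed: "map ?t ks = ks" if "a \<notin> set ks" "b \<notin> set ks" for ks
      using that by (intro map_idI) (metis transpose_apply_other)
    have notin: "a \<notin> set xs" "b \<notin> set xs" "a \<notin> set ys" "b \<notin> set ys" "a \<notin> set zs" "b \<notin> set zs"
      using that by (auto simp: doubleton_eq_iff)
    have "?t u = v" "?t v = u"
      using that(3) by (auto simp: doubleton_eq_iff)
    then have "map ?t js = xs @ [v] @ ys @ [u] @ zs"
      using that(1) fixed[OF notin(1,2)] fixed[OF notin(3,4)] fixed[OF notin(5,6)] by simp
    then show ?thesis
      by (simp only: that(1) prod_list_anticommute_swap[of c, OF anti, of xs v ys u zs])
  qed
  obtain xs ys where xy: "?js = xs @ [a] @ ys"
    using swap.hyps(1) set by (metis append_Cons append_Nil split_list)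
  have "b \<in> set xs \<or> b \<in> set ys"
    using swap.hyps(2,3) set xy by (metis Un_iff append_Cons append_Nil set_ConsD set_append)
  then have "prod_list (map c (map ?t ?js)) = - prod_list (map c ?js)"
  proof
    assume "b \<in> set xs"
    then obtain us vs where "xs = us @ b # vs"
      by (meson split_list)
    then show ?thesis
      using step[of ?js us b vs a ys] dist xy by auto
  next
    assume "b \<in> set ys"
    then obtain us vs where "ys = us @ b # vs"
      by (meson split_list)
    then show ?thesis
      using step[of ?js xs a us b vs] dist xy by auto
  qed
  moreover have "sign (?t \<circ> p) = - sign p"
  proof -
    have "permutation p"
      using swap.hyps(4) permutation_permutes by blast
    then show ?thesis
      using swap.hyps(3) by (simp add: sign_compose sign_swap_id permutation_swap_id)
  qed
  ultimately show ?case
    using swap.IH by (simp add: comp_def)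
qed simp

lemma sum_power_lists:
  fixes f :: "'b \<Rightarrow> 'a::ring_1"
  assumes "finite S"
  shows "(\<Sum>j\<in>S. f j) ^ m = (\<Sum>js | set js \<subseteq> S \<and> length js = m. prod_list (map f js))"
proof (induction m)
  case 0
  have "{js :: 'b list. set js \<subseteq> S \<and> js = []} = {[]}"
    by auto
  then show ?case by simp
next
  case (Suc m)
  let ?L = "\<lambda>m. {js. set js \<subseteq> S \<and> length js = m}"
  have "?L (Suc m) = (\<lambda>(j, js). j # js) ` (S \<times> ?L m)"
    by (auto simp: length_Suc_conv image_iff)
  moreover have "inj_on (\<lambda>(j, js). j # js) (S \<times> ?L m)"
    by (auto simp: inj_on_def)
  ultimately have "(\<Sum>js\<in>?L (Suc m). prod_list (map f js))
      = (\<Sum>(j, js)\<in>S \<times> ?L m. f j * prod_list (map f js))"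
    by (simp add: sum.reindex split_def)
  also have "\<dots> = (\<Sum>j\<in>S. f j) * (\<Sum>js\<in>?L m. prod_list (map f js))"
    by (simp add: sum_product sum.cartesian_product)
  finally show ?case
    using Suc.IH by simp
qed

text \<open>Words with a repeated letter contribute 0; the remaining words of length
  \<open>n\<close> in \<open>n\<close> letters are the permutations, and sorting them yields the
  signs. \<open>F\<close> holds left coefficients, which need not commute with
  \<open>c\<close>.\<close>

lemma sum_lists_anticommute:
  fixes c :: "nat \<Rightarrow> 'a::ring_1"
  assumes anti: "\<And>i j. c i * c j = - (c j * c i)" and sq: "\<And>i. c i * c i = 0"
  shows "(\<Sum>js | set js \<subseteq> {..<n} \<and> length js = n. F js * prod_list (map c js))
    = (\<Sum>\<sigma> | \<sigma> permutes {..<n}. F (map \<sigma> [0..<n]) * (of_int (sign \<sigma>) * prod_list (map c [0..<n])))"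
proof -
  let ?L = "{js. set js \<subseteq> {..<n} \<and> length js = n}" and ?g = "\<lambda>\<sigma>. map \<sigma> [0..<n]"
  have image: "?g ` {\<sigma>. \<sigma> permutes {..<n}} = {js\<in>?L. distinct js}"
  proof (intro equalityI subsetI)
    fix js
    assume "js \<in> {js\<in>?L. distinct js}"
    then have js: "set js \<subseteq> {..<n}" "distinct js" "n = length js"
      by auto
    \<comment> \<open>Extended by the identity from \<open>n\<close> on, as \<open>permutes\<close>
      demands.\<close>
    define \<sigma> where "\<sigma> k = (if k < n then js ! k else k)" for k
    have "bij_betw ((!) js) {..<n} {..<n}"
      using js by (metis bij_betw_nth card_lessThan card_subset_eq distinct_card finite_lessThan)
    then have "bij_betw \<sigma> {..<n} {..<n}"
      by (rule bij_betw_cong[THEN iffD1, rotated]) (simp add: \<sigma>_def)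
    then have "\<sigma> permutes {..<n}"
      by (rule bij_imp_permutes) (simp add: \<sigma>_def)
    moreover have "js = ?g \<sigma>"
      using js by (intro nth_equalityI) (auto simp: \<sigma>_def)
    ultimately show "js \<in> ?g ` {\<sigma>. \<sigma> permutes {..<n}}"
      by blast
  next
    fix js
    assume "js \<in> ?g ` {\<sigma>. \<sigma> permutes {..<n}}"
    then obtain \<sigma> where "\<sigma> permutes {..<n}" "js = ?g \<sigma>"
      by blast
    then show "js \<in> {js\<in>?L. distinct js}"
      using permutes_image[of \<sigma> "{..<n}"] permutes_inj_on[of \<sigma> "{..<n}"]
      by (simp add: distinct_map atLeast0LessThan)
  qed
  have inj: "inj_on ?g {\<sigma>. \<sigma> permutes {..<n}}"
  proof (rule inj_onI, rule ext)
    fix \<sigma> \<tau> x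
    assume "\<sigma> \<in> {\<sigma>. \<sigma> permutes {..<n}}" "\<tau> \<in> {\<sigma>. \<sigma> permutes {..<n}}" "?g \<sigma> = ?g \<tau>"
    then show "\<sigma> x = \<tau> x"
      by (cases "x < n") (auto simp: permutes_def)
  qed
  have "(\<Sum>js\<in>?L. F js * prod_list (map c js)) = (\<Sum>js\<in>{js\<in>?L. distinct js}. F js * prod_list (map c js))"
    by (rule sum.mono_neutral_right)
      (auto simp: finite_lists_length_eq prod_list_anticommute_not_distinct[of c, OF anti sq])
  also have "\<dots> = (\<Sum>\<sigma> | \<sigma> permutes {..<n}. F (?g \<sigma>) * prod_list (map c (?g \<sigma>)))"
    unfolding image[symmetric] using inj by (simp only: sum.reindex comp_def)
  also have "\<dots> = (\<Sum>\<sigma> | \<sigma> permutes {..<n}. F (?g \<sigma>) * (of_int (sign \<sigma>) * prod_list (map c [0..<n])))"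
    by (rule sum.cong) (simp_all only: prod_list_anticommute_permutes[of c, OF anti] mem_Collect_eq)
  finally show ?thesis .
qed

section \<open>Homological perturbation\<close>

lemma geometric_sum_noncomm:
  fixes x :: "'a::ring_1"
  shows "(1 - x) * (\<Sum>k\<le>n. x ^ k) = 1 - x ^ Suc n" "(\<Sum>k\<le>n. x ^ k) * (1 - x) = 1 - x ^ Suc n"
proof -
  show "(1 - x) * (\<Sum>k\<le>n. x ^ k) = 1 - x ^ Suc n"
  proof (induction n)
    case (Suc n)
    then show ?case
      by (simp only: sum.atMost_Suc distrib_left) (simp add: left_diff_distrib)
  qed simp
  show "(\<Sum>k\<le>n. x ^ k) * (1 - x) = 1 - x ^ Suc n"
  proof (induction n)
    case (Suc n)
    then show ?case
      by (simp only: sum.atMost_Suc distrib_right) (simp add: right_diff_distrib power_commutes mult.assoc)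
  qed simp
qed

text \<open>\<open>N\<close> stands for the connection, \<open>Z\<close> for the projection to form
  degree 0, and \<open>K\<close> inverts the Laplacian \<open>\<delta> * N + N * \<delta>\<close>
  off degree 0. The square of the perturbation \<open>D\<close> need not vanish; it only commutes
  with \<open>K * N\<close>.\<close>

locale perturbation =
  fixes D \<delta> N K Z :: "'e::ring_1" and n :: nat
  assumes \<delta>_sq: "\<delta> * \<delta> = 0" and N_sq: "N * N = 0"
    and inverse: "(\<delta> * N + N * \<delta>) * K = 1 - Z" "K * (\<delta> * N + N * \<delta>) = 1 - Z"
    and ZK: "Z * K = 0" and \<delta>Z: "\<delta> * Z = 0" and ZN: "Z * N = 0"
    and ZD: "Z * D = D * Z"
    and anti: "D * \<delta> = - (\<delta> * D)"
    and D_sq: "D * D * (K * N) = (K * N) * (D * D)"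
    and nilpotent: "(K * N * D) ^ Suc n = 0"
begin

definition "H = K * N"
text \<open>In degree 0, \<open>P\<close> picks the horizontal representative of a class modulo
  \<open>t\<close>: it kills the image of \<open>\<delta>\<close> (\<open>P_delta\<close>) and has
  values in the kernel of \<open>N\<close> (\<open>N_P\<close>).\<close>

definition "P = Z * (1 - \<delta> * K * N)"
text \<open>The Neumann series for the inverse of \<open>1 + H * D\<close>, finite by
  \<open>nilpotent\<close>.\<close>

definition "A = (\<Sum>k\<le>n. (- (H * D)) ^ k)"
definition "T = D + \<delta>"

text \<open>Since \<open>\<delta>\<close> squares to zero it commutes with the Laplacian, hence with
  \<open>K\<close> up to a correction, because \<open>K\<close> is an inverse only off degree
  0.\<close>

lemma K_delta: "K * \<delta> = \<delta> * K - Z * \<delta> * K"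
proof -
  let ?M = "\<delta> * N + N * \<delta>"
  have M\<delta>: "?M * \<delta> = \<delta> * ?M"
    by (simp add: distrib_left distrib_right mult.assoc \<delta>_sq mult_left_assoc[OF \<delta>_sq])
  have "K * \<delta> = K * \<delta> * (?M * K)"
    by (simp only: inverse) (simp add: right_diff_distrib mult.assoc \<delta>Z)
  also have "\<dots> = K * (\<delta> * ?M) * K"
    by (simp only: mult.assoc)
  also have "\<dots> = (K * ?M) * \<delta> * K"
    by (simp only: M\<delta>[symmetric] mult.assoc)
  finally show ?thesis
    by (simp only: inverse) (simp add: left_diff_distrib mult.assoc)
qed

lemma decomposition: "\<delta> * H + H * \<delta> = 1 - P"
proof -
  have "K * N * \<delta> = K * (\<delta> * N + N * \<delta>) - K * \<delta> * N"
    by (simp add: algebra_simps)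
  then show ?thesis
    by (simp only: inverse K_delta H_def P_def) (simp add: algebra_simps)
qed

text \<open>By \<open>N_sq\<close> the connection commutes with the Laplacian, so it moves past
  \<open>K\<close> and meets the other \<open>N\<close>; the correction term dies by
  \<open>ZN\<close>.\<close>

lemma N_H: "N * H = 0"
proof -
  let ?M = "\<delta> * N + N * \<delta>"
  have MN: "?M * N = N * ?M"
    by (simp add: distrib_left distrib_right mult.assoc N_sq mult_left_assoc[OF N_sq])
  have "(K * ?M) * N * K = K * (?M * N) * K"
    by (simp only: mult.assoc)
  also have "\<dots> = K * N * (?M * K)"
    by (simp only: MN mult.assoc)
  finally have "N * K = K * N - K * N * Z"
    by (simp only: inverse) (simp add: left_diff_distrib right_diff_distrib mult.assoc mult_left_assoc[OF ZN])
  then have "N * K * N = K * (N * N) - K * N * (Z * N)"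
    by (simp add: left_diff_distrib mult.assoc)
  then show ?thesis
    by (simp add: H_def N_sq ZN mult.assoc)
qed

lemma H_H: "H * H = 0"
  using N_H by (simp add: H_def mult.assoc)

lemma delta_P: "\<delta> * P = 0"
  by (simp add: P_def flip: mult.assoc) (simp add: \<delta>Z)

lemma P_delta: "P * \<delta> = 0"
proof -
  have P: "P = 1 - \<delta> * H - H * \<delta>"
    using decomposition by (simp add: algebra_simps)
  have "P * \<delta> = \<delta> - \<delta> * H * \<delta> - H * (\<delta> * \<delta>)" "\<delta> * P = \<delta> - (\<delta> * \<delta>) * H - \<delta> * H * \<delta>"
    by (simp_all add: P algebra_simps)
  then show ?thesis
    using delta_P by (simp add: \<delta>_sq)
qed

lemma P_Z: "P * Z = P"
proof -
  have PN: "P * N = 0"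
    by (simp add: P_def left_diff_distrib right_diff_distrib mult.assoc ZN N_sq)
  have "P * ((\<delta> * N + N * \<delta>) * K) = 0"
    by (simp add: distrib_left distrib_right mult_left_assoc[OF P_delta] mult_left_assoc[OF PN] mult.assoc)
  then show ?thesis
    by (simp only: inverse) (simp add: right_diff_distrib)
qed

text \<open>\<open>H\<close> ends in positive degree, \<open>D\<close> keeps the degree, and
  \<open>P\<close> only sees degree 0 (\<open>P_Z\<close>).\<close>

lemma P_D_H: "P * D * H = 0"
proof -
  have "P * D * H = P * (Z * D) * K * N"
    by (simp only: H_def mult.assoc mult_left_assoc[OF P_Z])
  also have "\<dots> = P * D * (Z * K) * N"
    by (simp only: ZD mult.assoc)
  finally show ?thesis
    by (simp add: ZK)
qed

lemma N_P: "N * P = 0"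
proof -
  let ?M = "\<delta> * N + N * \<delta>"
  have P: "P = 1 - \<delta> * H - H * \<delta>"
    using decomposition by (simp add: algebra_simps)
  have "N * (\<delta> * H) = (?M * K) * N - \<delta> * (N * H)"
    by (simp add: H_def algebra_simps)
  also have "\<dots> = N"
    by (simp only: inverse N_H) (simp add: left_diff_distrib ZN)
  finally show ?thesis
    by (simp add: P right_diff_distrib mult_left_assoc[OF N_H])
qed

lemma A_inverse: "(1 + H * D) * A = 1" "A * (1 + H * D) = 1"
proof -
  have "(- (H * D)) ^ Suc n = 0"
    using nilpotent by (simp only: H_def power_minus[of "K * N * D"]) simp
  then show "(1 + H * D) * A = 1" "A * (1 + H * D) = 1"
    using geometric_sum_noncomm[of "- (H * D)" n] by (simp_all only: A_def) simp_all
qed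

lemma A_eq: "A = 1 - H * D * A"
  using A_inverse(1) by (simp add: algebra_simps)

lemma H_A_H: "H * (A * H) = 0"
proof -
  have "H * A = H"
    by (subst A_eq) (simp add: right_diff_distrib mult.assoc mult_left_assoc[OF H_H])
  then show ?thesis
    by (simp add: H_H flip: mult.assoc)
qed

text \<open>The perturbation lemma with curvature \<open>D * D\<close>. Both sides are compared
  after multiplication by the invertible \<open>1 + H * D\<close>, where they reduce to
  \<open>decomposition\<close>. The curvature term vanishes because \<open>D * D\<close> commutes
  with \<open>H\<close> and \<open>H * (A * H) = 0\<close>.\<close>

theorem homotopy: "T * (A * H) + (A * H) * T = 1 - A * P"
proof -
  have HDD: "H * (D * D) = D * D * H"
    using D_sq by (simp add: H_def)
  \<comment> \<open>Measures how far \<open>1 + H * D\<close> is from intertwining \<open>T\<close>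
    with \<open>\<delta>\<close>: the errors are a curvature term and \<open>P * D\<close>.\<close>
  have eq: "(1 + H * D) * T = \<delta> * (1 + H * D) + H * (D * D) + P * D"
  proof -
    have "H * D * \<delta> = - (H * \<delta> * D)"
      by (simp add: mult.assoc anti)
    also have "H * \<delta> = 1 - P - \<delta> * H"
      using decomposition by (simp add: algebra_simps)
    finally show ?thesis
      by (simp add: T_def algebra_simps)
  qed
  have "(1 + H * D) * (T * (A * H)) = (\<delta> * (1 + H * D) + H * (D * D) + P * D) * (A * H)"
    by (simp only: eq flip: mult.assoc)
  also have "\<dots> = \<delta> * ((1 + H * D) * A) * H + H * (D * D) * (A * H) + P * D * (A * H)"
    by (simp only: distrib_right[of _ _ "A * H"] mult.assoc)
  also have "H * (D * D) * (A * H) = D * D * (H * (A * H))"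
    by (simp only: HDD mult.assoc)
  also have "P * D * (A * H) = P * D * H - P * D * H * D * (A * H)"
    by (subst A_eq) (simp add: left_diff_distrib right_diff_distrib mult.assoc)
  finally have 1: "(1 + H * D) * (T * (A * H)) = \<delta> * H"
    by (simp add: A_inverse H_A_H P_D_H)
  have 2: "(1 + H * D) * (A * H * T) = H * T"
    by (simp only: mult.assoc mult_left_assoc[OF A_inverse(1)] mult_1)
  have 3: "(1 + H * D) * (1 - A * P) = 1 + H * D - P"
    by (simp only: right_diff_distrib mult_left_assoc[OF A_inverse(1)] mult_1 mult_1_right)
  have "(1 + H * D) * (T * (A * H) + A * H * T) = (1 + H * D) * (1 - A * P)"
    unfolding 3 distrib_left 1 2 using decomposition by (simp add: T_def algebra_simps)
  then have "A * (1 + H * D) * (T * (A * H) + A * H * T) = A * (1 + H * D) * (1 - A * P)"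
    by (simp only: mult.assoc)
  then show ?thesis
    by (simp only: A_inverse mult_1)
qed

lemma D_sq_T: "T * T = D * D"
  by (simp add: T_def algebra_simps \<delta>_sq anti)

lemma D_sq_A_H: "D * D * (A * H) = (A * H) * (D * D)"
proof -
  have HDD: "D * D * H = H * (D * D)"
    using D_sq by (simp add: H_def)
  have "D * D * (- (H * D)) ^ k = (- (H * D)) ^ k * (D * D)" for k
  proof (induction k)
    case (Suc k)
    have "D * D * (H * D) = H * D * (D * D)"
      using HDD by (simp only: mult.assoc[symmetric])
    then have "D * D * (- (H * D)) = - (H * D) * (D * D)"
      by simp
    then show ?case
      using Suc.IH by (simp only: power_Suc mult.assoc[symmetric]) (simp only: mult.assoc)
  qed simp
  then have "D * D * A = A * (D * D)"
    by (simp add: A_def sum_distrib_left sum_distrib_right)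
  then show ?thesis
    using HDD by (simp only: mult.assoc[symmetric]) (simp only: mult.assoc)
qed

text \<open>\<open>T * T = D * D\<close> commutes with \<open>A * H\<close>, so \<open>T\<close>
  commutes with the anticommutator of \<open>T\<close> and \<open>A * H\<close>, which is
  \<open>1 - A * P\<close>. \<open>P_delta\<close> then removes \<open>\<delta>\<close> from the
  right-hand \<open>T\<close>.\<close>

theorem chain_map: "T * (A * P) = A * P * D"
proof -
  have "T * (1 - A * P) = (1 - A * P) * T"
  proof -
    have "T * (T * (A * H)) = A * H * (T * T)"
      using D_sq_A_H by (simp only: D_sq_T flip: mult.assoc)
    then show ?thesis
      unfolding homotopy[symmetric] by (simp only: distrib_left distrib_right mult.assoc add.commute)
  qed
  then have "T * (A * P) = A * (P * T)"
    by (simp add: algebra_simps)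
  then show ?thesis
    by (simp add: T_def distrib_left P_delta mult.assoc)
qed

text \<open>The extra term \<open>D * N\<close> is free, since \<open>N\<close> kills the images of
  \<open>H\<close> and \<open>P\<close>. It completes \<open>N * D\<close> to an anticommutator,
  which for the Koszul complex is the \<open>S[t]\<close>-linear Atiyah class.\<close>

lemma perturbation_power: "(- (H * D)) ^ k * P = (K * - (N * D + D * N)) ^ k * P"
proof -
  have "N * ((- (H * D)) ^ k * P) = 0" for k
    by (cases k) (simp_all add: N_P mult.assoc mult_left_assoc[OF N_H])
  then have step: "- (H * D) * ((- (H * D)) ^ k * P) = K * - (N * D + D * N) * ((- (H * D)) ^ k * P)" for k
    by (simp add: H_def algebra_simps)
  show ?thesis
  proof (induction k)
    case (Suc k)
    have "(- (H * D)) ^ Suc k * P = K * - (N * D + D * N) * ((- (H * D)) ^ k * P)"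
      by (simp only: power_Suc mult.assoc[of _ _ P] step)
    then show ?case
      by (simp only: power_Suc mult.assoc[of _ _ P] Suc.IH)
  qed simp
qed

end

section \<open>Creation and annihilation operators\<close>

text \<open>
  An element \<open>y\<close> of \<open>\<Omega> \<otimes> X\<close> is encoded by its coefficients: \<open>y A\<close> belongs to the product of the \<open>dt\<^sub>j\<close>
  with \<open>j \<in> A\<close> in increasing order. The index sets \<open>A\<close> are arbitrary sets of naturals; degrees only
  count the elements below \<open>n\<close>, so that all operator identities hold without restricting \<open>A\<close>.
\<close>

definition ksgn :: "nat \<Rightarrow> nat set \<Rightarrow> 'b::comm_ring_1" where
  "ksgn j A = (- 1) ^ card {k\<in>A. k < j}"

lemma ksgn_sq [simp]: "ksgn j A * ksgn j A = 1" "ksgn j A * (ksgn j A * x) = x"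
  by (simp_all add: ksgn_def flip: mult.assoc power_add)

lemma ksgn_remove:
  assumes "k \<in> A"
  shows "ksgn j (A - {k}) = (if k < j then - ksgn j A else ksgn j A)"
proof (cases "k < j")
  case True
  have "finite {l\<in>A. l < j}"
    by (rule finite_subset[of _ "{..<j}"]) auto
  moreover have "{l\<in>A - {k}. l < j} = {l\<in>A. l < j} - {k}"
    by auto
  ultimately have "card {l\<in>A. l < j} = Suc (card {l\<in>A - {k}. l < j})"
    using True assms by (metis (mono_tags, lifting) card_Suc_Diff1 mem_Collect_eq)
  then show ?thesis
    using True by (simp add: ksgn_def)
next
  case False
  then have "{l\<in>A - {k}. l < j} = {l\<in>A. l < j}"
    by auto
  then show ?thesis
    using False by (simp add: ksgn_def)
qed

lemma ksgn_insert:
  assumes "k \<notin> A"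
  shows "ksgn j (insert k A) = (if k < j then - ksgn j A else ksgn j A :: 'b::comm_ring_1)"
proof -
  have "(ksgn j A :: 'b) = (if k < j then - ksgn j (insert k A) else ksgn j (insert k A))"
    using ksgn_remove[of k "insert k A" j] assms by simp
  then show ?thesis
    by simp
qed

lemma app_ksgn: "app f (ksgn j A * x) = ksgn j A * app f x"
  by (cases "even (card {k\<in>A. k < j})") (simp_all add: ksgn_def)

definition pw :: "'b::comm_ring_1 endo \<Rightarrow> (nat set \<Rightarrow> 'b) endo" where
  "pw f = endo (\<lambda>y A. app f (y A))"

text \<open>Left exterior multiplication by \<open>dt_j\<close>; \<open>ksgn\<close> counts the
  smaller factors it passes.\<close>

definition cr :: "nat \<Rightarrow> (nat set \<Rightarrow> 'b::comm_ring_1) endo" where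
  "cr j = endo (\<lambda>y A. if j \<in> A then ksgn j A * y (A - {j}) else 0)"

text \<open>Contraction with the dual of \<open>dt_j\<close>.\<close>

definition an :: "nat \<Rightarrow> (nat set \<Rightarrow> 'b::comm_ring_1) endo" where
  "an j = endo (\<lambda>y A. if j \<in> A then 0 else ksgn j A * y (insert j A))"

text \<open>The sign of the form degree. Operators \<open>pw f * eps n\<close> anticommute with
  \<open>cr j\<close> and \<open>an j\<close> for \<open>j < n\<close>, as the Koszul sign rule
  wants for odd \<open>f\<close>.\<close>

definition eps :: "nat \<Rightarrow> (nat set \<Rightarrow> 'b::comm_ring_1) endo" where
  "eps n = endo (\<lambda>y A. (- 1) ^ card (A \<inter> {..<n}) * y A)"

lemma app_pw: "app (pw f) y A = app f (y A)"
  unfolding pw_def by (subst app_endo) (auto simp: additive_map_def fun_eq_iff)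

lemma app_cr: "app (cr j) y A = (if j \<in> A then ksgn j A * y (A - {j}) else 0)"
  unfolding cr_def by (subst app_endo) (auto simp: additive_map_def fun_eq_iff algebra_simps)

lemma app_an: "app (an j) y A = (if j \<in> A then 0 else ksgn j A * y (insert j A))"
  unfolding an_def by (subst app_endo) (auto simp: additive_map_def fun_eq_iff algebra_simps)

lemma app_eps: "app (eps n) y A = (- 1) ^ card (A \<inter> {..<n}) * y A"
  unfolding eps_def by (subst app_endo) (auto simp: additive_map_def fun_eq_iff algebra_simps)

lemma pw_hom:
  "pw 0 = 0" "pw 1 = 1" "pw (f + g) = pw f + pw g" "pw (f - g) = pw f - pw g" "pw (- f) = - pw f"
  "pw (f * g) = pw f * pw g"
  by (rule endo_eqI, rule ext, simp add: app_pw)+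

lemma cr_pw: "cr j * pw f = pw f * cr j"
  by (rule endo_eqI, rule ext) (simp add: app_pw app_cr app_ksgn)

lemma an_pw: "an j * pw f = pw f * an j"
  by (rule endo_eqI, rule ext) (simp add: app_pw app_an app_ksgn)

lemma eps_pw: "eps n * pw f = pw f * eps n"
proof (rule endo_eqI, rule ext)
  fix y A
  show "app (eps n * pw f) y A = app (pw f * eps n) y A"
    by (cases "even (card (A \<inter> {..<n}))") (simp_all add: app_pw app_eps)
qed

lemma cr_cr: "cr i * cr j = - (cr j * cr i)"
proof (rule endo_eqI, rule ext)
  fix y A
  show "app (cr i * cr j) y A = app (- (cr j * cr i)) y A"
    by (cases i j rule: linorder_cases) (auto simp: app_cr ksgn_remove Diff_insert2[symmetric] insert_commute mult.left_commute)
qed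

lemma cr_sq: "cr i * cr i = 0"
  by (rule endo_eqI, rule ext) (simp add: app_cr)

lemma an_an: "an i * an j = - (an j * an i)"
proof (rule endo_eqI, rule ext)
  fix y A
  show "app (an i * an j) y A = app (- (an j * an i)) y A"
    by (cases i j rule: linorder_cases) (auto simp: app_an ksgn_insert insert_commute mult.left_commute)
qed

lemma an_sq: "an i * an i = 0"
  by (rule endo_eqI, rule ext) (simp add: app_an)

text \<open>The Clifford relations. For \<open>i = j\<close> one term survives on each
  \<open>A\<close>; for \<open>i \<noteq> j\<close>, inserting or removing the smaller index flips
  the sign seen by the larger one.\<close>

lemma an_cr: "an i * cr j + cr j * an i = (if i = j then 1 else 0)"
proof (rule endo_eqI, rule ext)
  fix y A
  show "app (an i * cr j + cr j * an i) y A = app (if i = j then 1 else 0) y A"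
    by (cases i j rule: linorder_cases)
      (auto simp: app_an app_cr ksgn_insert ksgn_remove insert_absorb insert_Diff_if mult.left_commute)
qed

lemma card_remove: "(j::nat) \<in> A \<Longrightarrow> j < n \<Longrightarrow> card (A \<inter> {..<n}) = Suc (card ((A - {j}) \<inter> {..<n}))"
proof -
  assume "j \<in> A" "j < n"
  moreover have "(A - {j}) \<inter> {..<n} = A \<inter> {..<n} - {j}"
    by auto
  ultimately show ?thesis
    using card.remove[of "A \<inter> {..<n}" j] by simp
qed

lemma card_insert: "(j::nat) \<notin> A \<Longrightarrow> j < n \<Longrightarrow> card (insert j A \<inter> {..<n}) = Suc (card (A \<inter> {..<n}))"
  by simp

lemma eps_cr: "j < n \<Longrightarrow> eps n * cr j = - (cr j * eps n)"
  by (rule endo_eqI, rule ext) (simp add: app_eps app_cr card_remove mult.left_commute)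

lemma eps_an: "j < n \<Longrightarrow> eps n * an j = - (an j * eps n)"
  by (rule endo_eqI, rule ext) (simp add: app_eps app_an card_insert mult.left_commute)

lemma eps_sq: "eps n * eps n = 1"
  by (rule endo_eqI, rule ext) (simp add: app_eps flip: mult.assoc power_add)

lemma app_cr_an: "app (cr j * an j) y A = (if j \<in> A then y A else 0)"
  by (simp add: app_cr app_an ksgn_remove insert_absorb)

text \<open>Each \<open>cr j * an j\<close> projects onto the forms containing \<open>dt_j\<close>,
  so the sum counts the degree.\<close>

lemma sum_cr_an:
  "app (\<Sum>j<n. cr j * an j) y A = of_nat (card (A \<inter> {..<n})) * y A"
proof -
  have "app (\<Sum>j<n. cr j * an j) y A = (\<Sum>j<n. if j \<in> A then y A else 0)"
    by (induction n) (simp_all del: app_arith(6) add: app_cr_an)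
  also have "\<dots> = (\<Sum>j\<in>A \<inter> {..<n}. y A)"
    by (subst Int_commute) (rule sum.inter_restrict[symmetric], simp)
  finally show ?thesis
    by simp
qed

text \<open>Makes \<open>delta\<close> and \<open>nabla\<close> square to zero. The diagonal is a
  separate assumption because \<open>f i i = - f i i\<close> does not force 0 in characteristic
  2.\<close>

lemma sum_alternating_eq_zero:
  fixes f :: "nat \<Rightarrow> nat \<Rightarrow> 'a::ab_group_add"
  assumes "\<And>i j. i < n \<Longrightarrow> j < n \<Longrightarrow> f i j = - f j i" "\<And>i. i < n \<Longrightarrow> f i i = 0"
  shows "(\<Sum>i<n. \<Sum>j<n. f i j) = 0"
  using assms
proof (induction n)
  case (Suc n)
  have "(\<Sum>i<n. \<Sum>j<n. f i j) = 0"
    by (rule Suc.IH; rule Suc.prems; simp)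
  moreover have "(\<Sum>i<n. f i n) = - (\<Sum>i<n. f n i)"
    unfolding sum_negf[symmetric] by (rule sum.cong[OF refl], rule Suc.prems(1)) auto
  ultimately show ?case
    using Suc.prems(2)[of n] by (simp add: sum.distrib)
qed simp

definition emb :: "nat set \<Rightarrow> 'b::comm_ring_1 \<Rightarrow> nat set \<Rightarrow> 'b" where
  "emb B x = (\<lambda>A. if A = B then x else 0)"

lemma emb_add: "emb B (x + y) = emb B x + emb B y"
  by (auto simp: emb_def)

lemma emb_diff: "emb B (x - y) = emb B x - emb B y"
  by (auto simp: emb_def fun_eq_iff)

lemma app_pw_emb: "app (pw f) (emb B x) = emb B (app f x)"
  by (rule ext) (simp add: app_pw emb_def)

lemma app_eps_emb: "app (eps n) (emb B x) = emb B ((- 1) ^ card (B \<inter> {..<n}) * x)"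
  by (rule ext) (simp add: app_eps emb_def)

lemma app_cr_emb:
  assumes "\<And>k. k \<in> B \<Longrightarrow> m < k"
  shows "app (cr m) (emb B x) = emb (insert m B) x"
proof (rule ext)
  fix A
  have empty: "{k \<in> insert m B. k < m} = {}" and "m \<notin> B"
    using assms by (auto dest: order.asym)
  have "ksgn m (insert m B) * x = x"
    unfolding ksgn_def empty by simp
  moreover have "m \<in> A \<and> A - {m} = B \<longleftrightarrow> A = insert m B"
    using \<open>m \<notin> B\<close> by blast
  ultimately show "app (cr m) (emb B x) A = emb (insert m B) x A"
    by (auto simp: app_cr emb_def)
qed

lemma app_cr_list_emb: "app (prod_list (map cr [m..<m + k])) (emb {} x) = emb {m..<m + k} x"
proof (induction k arbitrary: m)
  case (Suc k)
  have "[m..<m + Suc k] = m # [Suc m..<Suc m + k]"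
    by (simp add: upt_conv_Cons)
  moreover have "insert m {Suc m..<Suc m + k} = {m..<m + Suc k}"
    by auto
  moreover have "app (cr m) (emb {Suc m..<Suc m + k} x) = emb (insert m {Suc m..<Suc m + k}) x"
    by (rule app_cr_emb) simp
  ultimately show ?case
    by (simp only: list.map prod_list.Cons app_arith Suc.IH)
qed simp

lemma eps_prod_list_cr:
  assumes "set js \<subseteq> {..<n}"
  shows "eps n * (prod_list (map cr js) * x) = (- 1) ^ length js * (prod_list (map cr js) * (eps n * x))"
  using assms
proof (induction js)
  case (Cons i js)
  then show ?case
    by (cases "even (length js)") (simp_all add: mult.assoc mult_left_assoc[OF eps_cr])
qed simp

text \<open>Every \<open>eps n\<close> moves right past all later \<open>cr\<close>; a word of
  length \<open>m\<close> thus costs 0 + 1 + ... + (m - 1) signs.\<close>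

lemma prod_list_cr_eps:
  assumes "set js \<subseteq> {..<n}"
  shows "prod_list (map (\<lambda>j. cr j * eps n) js)
    = (- 1) ^ (length js choose 2) * (prod_list (map cr js) * eps n ^ length js)"
  using assms
proof (induction js)
  case (Cons j js)
  have "Suc (length js) choose 2 = length js + (length js choose 2)"
    by (simp add: numeral_2_eq_2)
  then show ?case
    using Cons
    by (cases "even (length js)"; cases "even (length js choose 2)")
      (simp_all add: mult.assoc eps_prod_list_cr)
qed (simp add: numeral_2_eq_2)

section \<open>Endomorphisms of coordinate spaces\<close>

definition mat :: "'i set \<Rightarrow> ('i \<Rightarrow> 'i \<Rightarrow> 'r::comm_ring_1) \<Rightarrow> ('i \<Rightarrow> 'r) endo" where
  "mat I M = endo (mat_app I M)"

definition scal :: "'r::comm_ring_1 \<Rightarrow> ('i \<Rightarrow> 'r) endo" where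
  "scal r = endo (\<lambda>x i. r * x i)"

definition cw :: "('r::comm_ring_1 \<Rightarrow> 'r) \<Rightarrow> ('i \<Rightarrow> 'r) endo" where
  "cw f = endo (\<lambda>x i. f (x i))"

text \<open>
  Vectors supported on \<open>I\<close> do not form a type; identities such as \<open>d\<^sub>X\<^sup>2 = W\<close> therefore hold for
  endomorphisms of the full function space only up to the projection \<open>cut I\<close>.
\<close>

definition cut :: "'i set \<Rightarrow> ('i \<Rightarrow> 'r::comm_ring_1) endo" where
  "cut I = endo (\<lambda>x i. if i \<in> I then x i else 0)"

lemma app_mat: "app (mat I M) = mat_app I M"
  unfolding mat_def by (rule app_endo)
    (auto simp: additive_map_def mat_app_def fun_eq_iff algebra_simps sum.distrib)

lemma app_scal: "app (scal r) x = (\<lambda>i. r * x i)"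
  unfolding scal_def by (subst app_endo) (auto simp: additive_map_def fun_eq_iff algebra_simps)

lemma app_cw: "additive_map f \<Longrightarrow> app (cw f) x = (\<lambda>i. f (x i))"
  unfolding cw_def by (subst app_endo) (auto simp: additive_map_def fun_eq_iff)

lemma app_cut: "app (cut I) x = (\<lambda>i. if i \<in> I then x i else 0)"
  unfolding cut_def by (subst app_endo) (auto simp: additive_map_def fun_eq_iff)

lemma mat_scal: "mat I M * scal r = scal r * mat I M"
  by (rule endo_eqI) (auto simp: app_mat app_scal mat_app_def fun_eq_iff sum_distrib_left mult.left_commute)

lemma mat_cut: "mat I M * cut I = mat I M" "cut I * mat I M = mat I M"
  by (rule endo_eqI; auto simp: app_mat app_cut mat_app_def fun_eq_iff intro!: sum.cong)+

lemma scal_cut: "scal r * cut I = cut I * scal r"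
  by (rule endo_eqI) (auto simp: app_scal app_cut fun_eq_iff)

lemma scal_scal: "scal r * scal s = scal s * scal r"
  by (rule endo_eqI) (auto simp: app_scal fun_eq_iff mult.left_commute)

lemma additive_map_0: "additive_map f \<Longrightarrow> f 0 = 0"
  unfolding additive_map_def by (metis add_cancel_right_right)

lemma cw_cut: "additive_map f \<Longrightarrow> cw f * cut I = cut I * cw f"
  by (rule endo_eqI) (auto simp: app_cw app_cut fun_eq_iff additive_map_0)

lemma mat_mat:
  assumes "finite I"
  shows "mat I M * mat I N = mat I (\<lambda>i l. \<Sum>k\<in>I. M i k * N k l)"
proof (rule endo_eqI, rule ext)
  fix x i
  have "(\<Sum>k\<in>I. M i k * (\<Sum>l\<in>I. N k l * x l)) = (\<Sum>l\<in>I. (\<Sum>k\<in>I. M i k * N k l) * x l)"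
    unfolding sum_distrib_left sum_distrib_right by (subst sum.swap) (simp add: mult.assoc)
  then show "app (mat I M * mat I N) x i = app (mat I (\<lambda>i l. \<Sum>k\<in>I. M i k * N k l)) x i"
    by (simp add: app_mat mat_app_def)
qed

lemma mat_add: "mat I M + mat I N = mat I (\<lambda>i l. M i l + N i l)"
  by (rule endo_eqI) (auto simp: app_mat mat_app_def fun_eq_iff algebra_simps sum.distrib)

lemma mat_diagonal:
  assumes "finite I" "\<And>i l. i \<in> I \<Longrightarrow> l \<in> I \<Longrightarrow> M i l = (if i = l then r else 0)"
  shows "mat I M = scal r * cut I"
proof (rule endo_eqI, rule ext)
  fix x i
  have "(\<Sum>l\<in>I. M i l * x l) = (\<Sum>l\<in>I. if i = l then r * x l else 0)" if "i \<in> I"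
    using that assms(2) by (intro sum.cong) auto
  then show "app (mat I M) x i = app (scal r * cut I) x i"
    using assms(1) by (simp add: app_mat app_scal app_cut mat_app_def)
qed

lemma cut_vecs: "x \<in> vecs I \<Longrightarrow> app (cut I) x = x"
  by (auto simp: app_cut vecs_def)

lemma cut_in_vecs: "app (cut I) x \<in> vecs I"
  by (simp add: app_cut vecs_def)

section \<open>The Koszul complex of a matrix factorisation\<close>

lemma app_of_nat: "app f (of_nat m * y) = of_nat m * app f y" for y :: "'b::comm_ring_1"
  by (induction m) (simp_all add: algebra_simps)

lemma app_minus_one_power: "app f ((- 1) ^ k * y) = (- 1) ^ k * app f y" for y :: "'b::comm_ring_1"
  by (cases "even k") simp_all

lemma sum_fun: "(sum f S) x = (\<Sum>k\<in>S. f k x)"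
  by (induction S rule: infinite_finite_induct) simp_all

lemma tideal_zero: "0 \<in> tideal t n"
  unfolding tideal_def by (auto intro: exI[of _ "\<lambda>_. 0"])

lemma tidealI: "(\<Sum>j<n. t j * c j) \<in> tideal t n"
  unfolding tideal_def mem_Collect_eq by (rule exI[of _ c], rule refl)

lemma tideal_add: "x \<in> tideal t n \<Longrightarrow> y \<in> tideal t n \<Longrightarrow> x + y \<in> tideal t n"
proof -
  assume "x \<in> tideal t n" "y \<in> tideal t n"
  then obtain c d where "x = (\<Sum>j<n. t j * c j)" "y = (\<Sum>j<n. t j * d j)"
    by (auto simp: tideal_def)
  then have "x + y = (\<Sum>j<n. t j * (c j + d j))"
    by (simp add: distrib_left sum.distrib)
  then show ?thesis
    by (simp only: tidealI)
qed

lemma tideal_mult: "x \<in> tideal t n \<Longrightarrow> r * x \<in> tideal t n"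
proof -
  assume "x \<in> tideal t n"
  then obtain c where "x = (\<Sum>j<n. t j * c j)"
    by (auto simp: tideal_def)
  then have "r * x = (\<Sum>j<n. t j * (r * c j))"
    by (simp add: sum_distrib_left mult.left_commute)
  then show ?thesis
    by (simp only: tidealI)
qed

lemma tideal_minus: "x \<in> tideal t n \<Longrightarrow> - x \<in> tideal t n"
  using tideal_mult[of x t n "- 1"] by simp

lemma tideal_sum: "(\<And>k. k \<in> S \<Longrightarrow> f k \<in> tideal t n) \<Longrightarrow> sum f S \<in> tideal t n"
  by (induction S rule: infinite_finite_induct) (auto simp: tideal_zero tideal_add)

lemma zero_in_tvecs: "0 \<in> tvecs I t n"
  by (simp add: tvecs_def vecs_def tideal_zero)

lemma app_of_int_sign: "app (of_int (sign \<sigma>)) y = of_int (sign \<sigma>) * y"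
  for y :: "'b::comm_ring_1"
  by (cases \<sigma> rule: sign_cases) simp_all

lemma emb_zero: "emb B 0 = 0"
  by (auto simp: emb_def)

lemma emb_sum: "emb B (sum f S) = (\<Sum>k\<in>S. emb B (f k))"
  by (induction S rule: infinite_finite_induct) (simp_all add: emb_add emb_zero)

locale koszul =
  fixes phi :: "'s::comm_ring_1 \<Rightarrow> 'r::comm_ring_1"
    and W :: 's
    and I :: "'i set" and par :: "'i \<Rightarrow> bool" and D :: "'i \<Rightarrow> 'i \<Rightarrow> 'r"
    and n :: nat and t :: "nat \<Rightarrow> 'r"
    and L :: "nat \<Rightarrow> 'i \<Rightarrow> 'i \<Rightarrow> 'r"
    and del :: "nat \<Rightarrow> 'r \<Rightarrow> 'r"
  assumes Q: "Q_algebra TYPE('s)"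
    and phi: "ring_morphism phi"
    and mf: "matrix_factorisation I par D (phi W)"
    and L: "\<forall>j<n. odd_mat I par (L j)
           \<and> (\<forall>i\<in>I. \<forall>l\<in>I. (\<Sum>k\<in>I. L j i k * D k l + D i k * L j k l) = (if i = l then t j else 0))"
    and standard: "standard_connection phi t n del"
begin

lemma finite_I: "finite I" and D_odd: "odd_mat I par D"
  using mf by (simp_all add: matrix_factorisation_def)

lemma del_additive: "j < n \<Longrightarrow> additive_map (del j)"
  and del_phi: "j < n \<Longrightarrow> del j (phi a * x) = phi a * del j x"
  and del_t: "j < n \<Longrightarrow> k < n \<Longrightarrow> del j (t k * x) = t k * del j x + (if j = k then x else 0)"
  and del_commute: "j < n \<Longrightarrow> k < n \<Longrightarrow> del j (del k x) = del k (del j x)"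
  using standard by (simp_all add: standard_connection_def connection_def flat_connection_def additive_map_def)

section \<open>The Euler operator and the inverses of its positive translates\<close>

abbreviation "euler \<equiv> euler_op t n del"

lemma euler_additive: "euler (x + y) = euler x + euler y"
  using del_additive by (simp add: euler_op_def additive_map_def distrib_left sum.distrib)

lemma euler_phi: "euler (phi a * x) = phi a * euler x"
  by (simp add: euler_op_def del_phi sum_distrib_left mult.left_commute)

lemma euler_tideal: "euler x \<in> tideal t n"
  unfolding euler_op_def by (rule tidealI)

definition Kinv :: "nat \<Rightarrow> 'r \<Rightarrow> 'r" where
  "Kinv p = inv (\<lambda>r. of_nat p * r + euler r)"

lemma
  assumes "p > 0"
  shows Kinv_right: "of_nat p * Kinv p r + euler (Kinv p r) = r"
    and Kinv_left: "Kinv p (of_nat p * r + euler r) = r"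
proof -
  have bij: "bij (\<lambda>r. of_nat p * r + euler r)"
    using standard assms by (simp add: standard_connection_def)
  show "of_nat p * Kinv p r + euler (Kinv p r) = r"
    using surj_f_inv_f[OF bij_is_surj[OF bij]] by (simp add: Kinv_def)
  show "Kinv p (of_nat p * r + euler r) = r"
    using inv_f_f[OF bij_is_inj[OF bij]] by (simp add: Kinv_def)
qed

lemma Kinv_additive:
  assumes "p > 0"
  shows "Kinv p (x + y) = Kinv p x + Kinv p y"
proof -
  have "x + y = of_nat p * (Kinv p x + Kinv p y) + euler (Kinv p x + Kinv p y)"
    using Kinv_right[OF assms, of x] Kinv_right[OF assms, of y]
    by (simp add: euler_additive distrib_left) (metis add.assoc add.left_commute)
  then show ?thesis
    using Kinv_left[OF assms] by metis
qed

lemma Kinv_phi: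
  assumes "p > 0"
  shows "Kinv p (phi a * x) = phi a * Kinv p x"
proof -
  have "phi a * x = phi a * (of_nat p * Kinv p x + euler (Kinv p x))"
    using Kinv_right[OF assms] by simp
  also have "\<dots> = of_nat p * (phi a * Kinv p x) + euler (phi a * Kinv p x)"
    by (simp add: euler_phi distrib_left mult.left_commute)
  finally show ?thesis
    using Kinv_left[OF assms] by metis
qed

lemma Kinv_zero: "p > 0 \<Longrightarrow> Kinv p 0 = 0"
  using Kinv_additive[of p 0 0] by simp

definition deg :: "nat set \<Rightarrow> nat" where
  "deg A = card (A \<inter> {..<n})"

lemma deg_eq_0: "deg A = 0 \<longleftrightarrow> A \<inter> {..<n} = {}"
  by (simp add: deg_def)

lemma deg_remove: "j \<in> A \<Longrightarrow> j < n \<Longrightarrow> deg A = Suc (deg (A - {j}))"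
  by (simp only: deg_def card_remove)

lemma deg_insert: "j \<notin> A \<Longrightarrow> j < n \<Longrightarrow> deg (insert j A) = Suc (deg A)"
  by (simp add: deg_def)

lemma app_eps_deg: "app (eps n) y A = (- 1) ^ deg A * y A"
  by (simp add: app_eps deg_def)

section \<open>Operators on \<open>\<Omega> \<otimes> X\<close> and the Koszul Laplacian\<close>

definition "Dop = pw (mat I D) * eps n"
definition "lam j = pw (mat I (L j)) * eps n"
definition delta :: "(nat set \<Rightarrow> 'i \<Rightarrow> 'r) endo" where
  "delta = (\<Sum>j<n. pw (scal (t j)) * an j)"
definition nabla :: "(nat set \<Rightarrow> 'i \<Rightarrow> 'r) endo" where
  "nabla = (\<Sum>j<n. pw (cw (del j)) * cr j)"
definition Z :: "(nat set \<Rightarrow> 'i \<Rightarrow> 'r) endo" where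
  "Z = endo (\<lambda>y A. if deg A = 0 then y A else 0)"
text \<open>Degree 0 gets the value 0: there the Laplacian is the Euler operator alone, outside the
  range \<open>p > 0\<close> of \<open>Kinv\<close>.\<close>

definition K :: "(nat set \<Rightarrow> 'i \<Rightarrow> 'r) endo" where
  "K = endo (\<lambda>y A i. if deg A = 0 then 0 else Kinv (deg A) (y A i))"

lemma app_Z: "app Z y A = (if deg A = 0 then y A else 0)"
  unfolding Z_def by (subst app_endo) (auto simp: additive_map_def fun_eq_iff)

lemma app_K: "app K y A i = (if deg A = 0 then 0 else Kinv (deg A) (y A i))"
  unfolding K_def by (subst app_endo) (auto simp: additive_map_def fun_eq_iff Kinv_additive)

lemma cw_scal:
  assumes "i < n" "j < n"
  shows "cw (del j) * scal (t i) = scal (t i) * cw (del j) + (if i = j then 1 else (0 :: ('i \<Rightarrow> 'r) endo))"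
  using assms by (intro endo_eqI) (auto simp: app_cw app_scal del_additive del_t fun_eq_iff)

lemma cw_cw: "i < n \<Longrightarrow> j < n \<Longrightarrow> cw (del i) * cw (del j) = (cw (del j) * cw (del i) :: ('i \<Rightarrow> 'r) endo)"
  by (intro endo_eqI) (auto simp: app_cw del_additive del_commute fun_eq_iff)

lemma delta_sq: "delta * delta = 0"
proof -
  have "delta * delta = (\<Sum>i<n. \<Sum>j<n. pw (scal (t i) * scal (t j)) * (an i * an j))"
    by (simp add: delta_def sum_product pw_hom mult.assoc mult_left_assoc[OF an_pw])
  also have "\<dots> = 0"
  proof (rule sum_alternating_eq_zero)
    fix i j
    show "pw (scal (t i) * scal (t j)) * (an i * an j) = - (pw (scal (t j) * scal (t i)) * (an j * an i))"
      by (subst an_an, subst scal_scal) simp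
  qed (simp add: an_sq)
  finally show ?thesis .
qed

lemma nabla_sq: "nabla * nabla = 0"
proof -
  have "nabla * nabla = (\<Sum>i<n. \<Sum>j<n. pw (cw (del i) * cw (del j)) * (cr i * cr j))"
    by (simp add: nabla_def sum_product pw_hom mult.assoc mult_left_assoc[OF cr_pw])
  also have "\<dots> = 0"
  proof (rule sum_alternating_eq_zero)
    fix i j
    assume "i < n" "j < n"
    show "pw (cw (del i) * cw (del j)) * (cr i * cr j)
        = - (pw (cw (del j) * cw (del i)) * (cr j * cr i) :: (nat set \<Rightarrow> 'i \<Rightarrow> 'r) endo)"
      by (simp only: cr_cr[of i j] cw_cw[OF \<open>i < n\<close> \<open>j < n\<close>] mult_minus_right)
  qed (simp add: cr_sq)
  finally show ?thesis .
qed

text \<open>Cartan's formula. The Leibniz rule \<open>cw_scal\<close> and the Clifford relations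
  \<open>an_cr\<close> cancel all off-diagonal terms, leaving the Euler operator and the degree
  operator.\<close>

lemma laplacian:
  "delta * nabla + nabla * delta = (\<Sum>i<n. pw (scal (t i) * cw (del i))) + (\<Sum>i<n. cr i * an i)"
proof -
  have 1: "delta * nabla = (\<Sum>i<n. \<Sum>j<n. pw (scal (t i) * cw (del j)) * (an i * cr j))"
    by (simp add: delta_def nabla_def sum_product pw_hom mult.assoc mult_left_assoc[OF an_pw])
  have "nabla * delta = (\<Sum>j<n. \<Sum>i<n. pw (cw (del j) * scal (t i)) * (cr j * an i))"
    by (simp add: delta_def nabla_def sum_product pw_hom mult.assoc mult_left_assoc[OF cr_pw])
  also have "\<dots> = (\<Sum>i<n. \<Sum>j<n. pw (cw (del j) * scal (t i)) * (cr j * an i))"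
    by (rule sum.swap)
  finally have 2: "nabla * delta = (\<Sum>i<n. \<Sum>j<n. pw (cw (del j) * scal (t i)) * (cr j * an i))" .
  have "delta * nabla + nabla * delta
      = (\<Sum>i<n. \<Sum>j<n. if i = j then pw (scal (t i) * cw (del j)) + cr j * an i else 0)"
    unfolding 1 2 sum.distrib[symmetric]
  proof (intro sum.cong refl)
    fix i j
    assume "i \<in> {..<n}" "j \<in> {..<n}"
    then have "i < n" "j < n"
      by simp_all
    have "pw (scal (t i) * cw (del j)) * (an i * cr j) + pw (cw (del j) * scal (t i)) * (cr j * an i)
        = pw (scal (t i) * cw (del j)) * (an i * cr j + cr j * an i)
          + (if i = j then cr j * an i else 0 :: (nat set \<Rightarrow> 'i \<Rightarrow> 'r) endo)"
      by (simp only: cw_scal[OF \<open>i < n\<close> \<open>j < n\<close>]) (simp add: pw_hom distrib_left distrib_right)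
    then show "pw (scal (t i) * cw (del j)) * (an i * cr j) + pw (cw (del j) * scal (t i)) * (cr j * an i)
        = (if i = j then pw (scal (t i) * cw (del j)) + cr j * an i else 0 :: (nat set \<Rightarrow> 'i \<Rightarrow> 'r) endo)"
      by (simp add: an_cr)
  qed
  also have "\<dots> = (\<Sum>i<n. pw (scal (t i) * cw (del i)) + cr i * an i)"
    by (intro sum.cong refl) simp
  finally show ?thesis
    by (simp add: sum.distrib)
qed

lemma app_laplacian:
  "app (delta * nabla + nabla * delta) y A i = of_nat (deg A) * y A i + euler (y A i)"
proof -
  have "app (\<Sum>i<n. pw (scal (t i) * cw (del i))) y A i = euler (y A i)"
    by (simp add: app_sum_left sum_fun app_pw app_scal app_cw del_additive euler_op_def)
  then show ?thesis
    unfolding laplacian using sum_cr_an[of n y A] by (simp add: add.commute deg_def)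
qed

lemma laplacian_K: "(delta * nabla + nabla * delta) * K = 1 - Z" "K * (delta * nabla + nabla * delta) = 1 - Z"
proof -
  have "app ((delta * nabla + nabla * delta) * K) y A i = app (1 - Z) y A i" for y A i
    unfolding app_arith(6) app_laplacian
    using Kinv_right[OF neq0_conv[THEN iffD1], of "deg A" "y A i"] euler_additive[of 0 0]
    by (simp add: app_K app_Z)
  then show "(delta * nabla + nabla * delta) * K = 1 - Z"
    by (intro endo_eqI ext)
  have "app (K * (delta * nabla + nabla * delta)) y A i = app (1 - Z) y A i" for y A i
    unfolding app_arith(6) app_K app_laplacian
    using Kinv_left[OF neq0_conv[THEN iffD1], of "deg A" "y A i"] by (simp add: app_Z)
  then show "K * (delta * nabla + nabla * delta) = 1 - Z"
    by (intro endo_eqI ext)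
qed

section \<open>Parity and \<open>S\<close>-linearity of the operators\<close>

definition Rop :: "bool \<Rightarrow> (nat set \<Rightarrow> 'i \<Rightarrow> 'r) endo" where
  "Rop b = endo (\<lambda>y A. par_proj par (b \<noteq> odd (deg A)) (y A))"

lemma app_Rop: "app (Rop b) y A = par_proj par (b \<noteq> odd (deg A)) (y A)"
  unfolding Rop_def by (subst app_endo) (auto simp: additive_map_def fun_eq_iff par_proj_def)

text \<open>
  \<open>Rop b\<close> projects onto one parity of the total grading of \<open>\<Omega> \<otimes> X\<close>; \<open>graded\<close> collects what
  \<open>lf_map\<close> asks for: linearity over \<open>S\<close>, compatibility with \<open>vecs I\<close>, and parity.
\<close>

definition graded :: "bool \<Rightarrow> (nat set \<Rightarrow> 'i \<Rightarrow> 'r) endo \<Rightarrow> bool" where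
  "graded ev f \<longleftrightarrow> (\<forall>a. f * pw (scal (phi a)) = pw (scal (phi a)) * f)
     \<and> f * pw (cut I) = pw (cut I) * f \<and> (\<forall>b. f * Rop b = Rop (b = ev) * f)"

text \<open>With \<open>True\<close> for even, \<open>e = e'\<close> is the parity of a
  composite.\<close>

lemma graded_mult:
  assumes "graded e f" "graded e' g"
  shows "graded (e = e') (f * g)"
proof -
  have comm: "f * g * x = x' * (f * g)" if "g * x = x'' * g" "f * x'' = x' * f" for x x' x''
    by (simp only: mult.assoc that(1)) (simp only: that(2) flip: mult.assoc)
  have "((b = e') = e) = (b = (e = e'))" for b
    by auto
  then have "f * g * Rop b = Rop (b = (e = e')) * (f * g)" for b
    using assms by (intro comm[where x'' = "Rop (b = e')"]) (simp_all add: graded_def)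
  moreover have "f * g * pw (scal (phi a)) = pw (scal (phi a)) * (f * g)" for a
    using assms by (intro comm[where x'' = "pw (scal (phi a))"]) (simp_all add: graded_def)
  moreover have "f * g * pw (cut I) = pw (cut I) * (f * g)"
    using assms by (intro comm[where x'' = "pw (cut I)"]) (simp_all add: graded_def)
  ultimately show ?thesis
    by (simp add: graded_def)
qed

lemma graded_zero: "graded e 0"
  by (simp add: graded_def)

lemma graded_one: "graded True 1"
  by (simp add: graded_def)

lemma graded_add: "graded e f \<Longrightarrow> graded e g \<Longrightarrow> graded e (f + g)"
  by (simp add: graded_def distrib_left distrib_right)

lemma graded_diff: "graded e f \<Longrightarrow> graded e g \<Longrightarrow> graded e (f - g)"
  by (simp add: graded_def left_diff_distrib right_diff_distrib)

lemma graded_minus: "graded e f \<Longrightarrow> graded e (- f)"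
  by (simp add: graded_def)

lemma graded_sum: "(\<And>k. k \<in> S \<Longrightarrow> graded e (f k)) \<Longrightarrow> graded e (sum f S)"
  by (induction S rule: infinite_finite_induct) (simp_all add: graded_zero graded_add)

lemma graded_power: "graded True f \<Longrightarrow> graded True (f ^ k)"
  by (induction k) (use graded_mult[of True f True] in \<open>simp_all add: graded_one\<close>)

lemma graded_prod_list: "(\<And>k. k \<in> set ks \<Longrightarrow> graded True (f k)) \<Longrightarrow> graded True (prod_list (map f ks))"
  by (induction ks) (use graded_mult[of True _ True] in \<open>simp_all add: graded_one\<close>)

lemma graded_pw:
  assumes "\<And>a. g * scal (phi a) = scal (phi a) * g" "g * cut I = cut I * g"
    and "\<And>b x. app g (par_proj par b x) = par_proj par (b = e) (app g x)"
  shows "graded e (pw g)"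
proof -
  have "pw g * Rop b = Rop (b = e) * pw g" for b
  proof (rule endo_eqI, rule ext)
    fix y A
    have "((b \<noteq> odd (deg A)) = e) = ((b = e) \<noteq> odd (deg A))"
      by auto
    then show "app (pw g * Rop b) y A = app (Rop (b = e) * pw g) y A"
      by (simp add: app_pw app_Rop assms(3))
  qed
  then show ?thesis
    using assms(1,2) by (simp add: graded_def flip: pw_hom)
qed

lemma graded_mat:
  assumes "odd_mat I par M"
  shows "graded False (pw (mat I M))"
proof (rule graded_pw)
  fix b x
  show "app (mat I M) (par_proj par b x) = par_proj par (b = False) (app (mat I M) x)"
  proof
    fix i
    have "M i k * par_proj par b x k = (if par i = b then 0 else M i k * x k)" if "i \<in> I" "k \<in> I" for k
      using assms that by (auto simp: odd_mat_def par_proj_def)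
    then show "app (mat I M) (par_proj par b x) i = par_proj par (b = False) (app (mat I M) x) i"
      by (auto simp: app_mat mat_app_def par_proj_def)
  qed
qed (simp_all add: mat_scal mat_cut)

lemma graded_scal: "graded True (pw (scal r))"
  by (rule graded_pw) (auto simp: scal_scal scal_cut app_scal par_proj_def)

lemma graded_cw:
  assumes "j < n"
  shows "graded True (pw (cw (del j)))"
proof (rule graded_pw)
  show "cw (del j) * scal (phi a) = scal (phi a) * cw (del j)" for a
    using assms by (intro endo_eqI) (simp add: app_cw app_scal del_additive del_phi)
  show "cw (del j) * cut I = cut I * cw (del j)"
    using assms by (simp add: cw_cut del_additive)
  show "app (cw (del j)) (par_proj par b x) = par_proj par (b = True) (app (cw (del j)) x)" for b x
    using assms by (auto simp: app_cw del_additive additive_map_0 par_proj_def)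
qed

lemma par_proj_sign: "par_proj par b ((- 1) ^ k * x) = (- 1) ^ k * par_proj par b x" for x :: "'i \<Rightarrow> 'r"
  by (cases "even k") (auto simp: par_proj_def)

lemma par_proj_zero: "par_proj par b (0 :: 'i \<Rightarrow> 'r) = 0"
  by (auto simp: par_proj_def)

lemma graded_eps: "graded True (eps n)"
  unfolding graded_def eps_pw
  by (intro conjI allI refl endo_eqI ext) (simp add: app_eps_deg app_Rop par_proj_sign)

lemma graded_cr:
  assumes "j < n"
  shows "graded False (cr j)"
  unfolding graded_def cr_pw using assms
  by (intro conjI allI refl endo_eqI ext)
    (auto simp: app_cr app_Rop par_proj_zero deg_remove ksgn_def par_proj_sign)

lemma graded_an:
  assumes "j < n"
  shows "graded False (an j)"
  unfolding graded_def an_pw using assms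
  by (intro conjI allI refl endo_eqI ext)
    (auto simp: app_an app_Rop par_proj_zero deg_insert ksgn_def par_proj_sign)

lemma graded_Z: "graded True Z"
  unfolding graded_def
  by (intro conjI allI refl endo_eqI ext) (auto simp: app_Z app_Rop app_pw par_proj_zero)

lemma graded_K: "graded True K"
  unfolding graded_def
  by (intro conjI allI refl endo_eqI ext)
    (auto simp: app_K app_Rop app_pw app_scal app_cut par_proj_def Kinv_zero Kinv_phi)

lemma graded_Dop: "graded False Dop"
  using graded_mult[OF graded_mat[OF D_odd] graded_eps] by (simp add: Dop_def)

lemma graded_lam: "j < n \<Longrightarrow> graded False (lam j)"
  using graded_mult[OF graded_mat graded_eps] L by (simp add: lam_def)

lemma graded_delta: "graded False delta"
  unfolding delta_def
  by (intro graded_sum) (use graded_mult[OF graded_scal graded_an] in simp)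

lemma graded_nabla: "graded False nabla"
  unfolding nabla_def
  by (intro graded_sum) (use graded_mult[OF graded_cw graded_cr] in simp)

section \<open>Curvature and nilpotence of the perturbation\<close>

lemma Dop_sq: "Dop * Dop = pw (scal (phi W)) * pw (cut I)"
proof -
  have "mat I D * mat I D = scal (phi W) * cut I"
    unfolding mat_mat[OF finite_I] using mf finite_I
    by (intro mat_diagonal) (auto simp: matrix_factorisation_def)
  then show ?thesis
    by (simp add: Dop_def mult.assoc mult_left_assoc[OF eps_pw] eps_sq flip: pw_hom)
qed

text \<open>\<open>W\<close> comes from \<open>S\<close>, so the curvature is built from the two
  kinds of operators with which every graded operator commutes.\<close>

lemma Dop_sq_commute:
  assumes "graded e f"
  shows "Dop * Dop * f = f * (Dop * Dop)"
proof -
  have comm: "f * pw (scal (phi W)) = pw (scal (phi W)) * f" "f * pw (cut I) = pw (cut I) * f"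
    using assms by (simp_all add: graded_def)
  show ?thesis
    by (simp only: Dop_sq mult.assoc comm mult_left_assoc[OF comm(1)])
qed

lemma pw_eps_an:
  assumes "f * g = g * f" "j < n"
  shows "pw f * eps n * (pw g * an j) = - (pw g * an j * (pw f * eps n))"
proof -
  have comm: "pw f * pw g = pw g * pw f"
    using assms(1) by (simp flip: pw_hom)
  have "pw f * eps n * (pw g * an j) = pw f * (eps n * pw g) * an j"
    by (simp only: mult.assoc)
  also have "\<dots> = pw f * pw g * (eps n * an j)"
    by (simp only: eps_pw mult.assoc)
  also have "\<dots> = - (pw g * (pw f * an j) * eps n)"
    using assms(2) by (simp only: comm eps_an) (simp add: mult.assoc)
  also have "\<dots> = - (pw g * an j * (pw f * eps n))"
    by (simp add: mult.assoc mult_left_assoc[OF an_pw])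
  finally show ?thesis .
qed

lemma Dop_delta: "Dop * delta = - (delta * Dop)"
  unfolding Dop_def delta_def sum_distrib_left sum_distrib_right sum_negf[symmetric]
  by (rule sum.cong[OF refl], rule pw_eps_an) (simp_all add: mat_scal)

definition supp :: "nat set \<Rightarrow> (nat set \<Rightarrow> 'i \<Rightarrow> 'r) \<Rightarrow> bool" where
  "supp S y \<longleftrightarrow> (\<forall>A. deg A \<notin> S \<longrightarrow> y A = 0)"

lemma supp_Dop: "supp S y \<Longrightarrow> supp S (app Dop y)"
  by (simp add: supp_def Dop_def app_pw app_eps_deg)

lemma supp_K: "supp S y \<Longrightarrow> supp S (app K y)"
  by (auto simp: supp_def fun_eq_iff app_K Kinv_zero)

lemma supp_cr: "j < n \<Longrightarrow> supp S y \<Longrightarrow> supp (Suc ` S) (app (cr j) y)"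
  by (auto simp: supp_def app_cr deg_remove)

lemma supp_sum: "(\<And>k. k \<in> B \<Longrightarrow> supp S (f k)) \<Longrightarrow> supp S (sum f B)"
  by (auto simp: supp_def sum_fun)

lemma supp_pw: "supp S y \<Longrightarrow> supp S (app (pw f) y)"
  by (simp add: supp_def app_pw)

lemma supp_nabla: "supp S y \<Longrightarrow> supp (Suc ` S) (app nabla y)"
  unfolding nabla_def app_sum_left by (intro supp_sum) (simp add: supp_pw supp_cr)

text \<open>\<open>nabla\<close> raises the form degree by one while \<open>K\<close> and
  \<open>Dop\<close> keep it, and no degree exceeds \<open>n\<close>.\<close>

lemma nilpotent: "(K * nabla * Dop) ^ Suc n = 0"
proof (rule endo_eqI, rule ext)
  fix y A
  have "supp {k..} (app ((K * nabla * Dop) ^ k) y)" for k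
  proof (induction k)
    case (Suc k)
    have "Suc ` {k..} = {Suc k..}"
      by (auto simp: image_iff dest: Suc_le_D)
    then show ?case
      using supp_K[OF supp_nabla[OF supp_Dop[OF Suc]]] by simp
  qed (simp add: supp_def)
  moreover have "deg A \<le> n"
    using card_mono[of "{..<n}" "A \<inter> {..<n}"] by (simp add: deg_def)
  ultimately show "app ((K * nabla * Dop) ^ Suc n) y A = app 0 y A"
    unfolding supp_def app_arith(1) zero_fun_apply by (metis atLeast_iff not_less_eq_eq)
qed

sublocale hp: perturbation Dop delta nabla K Z n
proof
  show "Z * K = 0"
    by (intro endo_eqI ext) (simp add: app_Z app_K)
  show "delta * Z = 0"
    by (intro endo_eqI ext) (auto simp: delta_def app_sum_left sum_fun app_pw app_scal app_an app_Z deg_insert intro!: sum.neutral)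
  show "Z * nabla = 0"
  proof (intro endo_eqI ext)
    fix y :: "nat set \<Rightarrow> 'i \<Rightarrow> 'r" and A i
    have "app (cr j) y A = 0" if "deg A = 0" "j < n" for j
      using that by (auto simp: app_cr deg_eq_0)
    then show "app (Z * nabla) y A i = app 0 y A i"
      by (simp add: app_Z nabla_def app_sum_left sum_fun app_pw)
  qed
  show "Z * Dop = Dop * Z"
    by (intro endo_eqI ext) (simp add: app_Z Dop_def app_pw app_eps_deg)
  show "Dop * Dop * (K * nabla) = K * nabla * (Dop * Dop)"
    by (rule Dop_sq_commute[OF graded_mult[OF graded_K graded_nabla]])
qed (fact delta_sq nabla_sq laplacian_K Dop_delta nilpotent)+

lemma graded_H: "graded False hp.H"
  unfolding hp.H_def using graded_mult[OF graded_K graded_nabla] by simp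

lemma graded_A: "graded True hp.A"
  unfolding hp.A_def
  by (intro graded_sum graded_power graded_minus) (use graded_mult[OF graded_H graded_Dop] in simp)

lemma graded_P: "graded True hp.P"
proof -
  have "graded True (delta * K * nabla)"
    using graded_mult[OF graded_mult[OF graded_delta graded_K] graded_nabla] by simp
  then show ?thesis
    unfolding hp.P_def using graded_mult[OF graded_Z graded_diff[OF graded_one]] by simp
qed

text \<open>Turns one matrix block of a graded operator on \<open>\<Omega> \<otimes> X\<close> into
  a map of linear factorisations; a form of degree \<open>card B\<close> shifts the parity of its
  coefficient.\<close>

lemma lf_map_block:
  assumes F: "graded ev F" and B: "B \<subseteq> {..<n}" "B' \<subseteq> {..<n}"
    and NA: "\<And>z. z \<in> NA \<Longrightarrow> z \<in> vecs I \<Longrightarrow> app F (emb B z) B' \<in> NB" and NB: "0 \<in> NB"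
  shows "lf_map phi I ev NA (shift_par (card B) par) NB (shift_par (card B') par) (\<lambda>x. app F (emb B x) B')"
  unfolding lf_map_def
proof (intro conjI ballI allI impI)
  have deg: "deg B = card B" "deg B' = card B'"
    using B by (simp_all add: deg_def Int_absorb2)
  fix x :: "'i \<Rightarrow> 'r"
  assume x: "x \<in> vecs I"
  have "emb B x = app (pw (cut I)) (emb B x)"
    using x by (simp add: app_pw_emb cut_vecs)
  then have "app F (emb B x) = app (F * pw (cut I)) (emb B x)"
    by simp
  also have "\<dots> = app (pw (cut I) * F) (emb B x)"
    using F by (simp add: graded_def)
  finally have "app F (emb B x) B' = app (pw (cut I) * F) (emb B x) B'"
    by (rule fun_cong)
  then have "app F (emb B x) B' = app (cut I) (app F (emb B x) B')"
    by (simp only: app_arith app_pw)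
  then show "app F (emb B x) B' \<in> vecs I"
    by (metis cut_in_vecs)
  show "app F (emb B (\<lambda>i. phi a * x i)) B' - (\<lambda>i. phi a * app F (emb B x) B' i) \<in> NB" for a
  proof -
    have "emb B (\<lambda>i. phi a * x i) = app (pw (scal (phi a))) (emb B x)"
      by (simp add: app_pw_emb app_scal)
    then have "app F (emb B (\<lambda>i. phi a * x i)) = app (F * pw (scal (phi a))) (emb B x)"
      by simp
    also have "\<dots> = app (pw (scal (phi a)) * F) (emb B x)"
      using F by (simp add: graded_def)
    finally show ?thesis
      using NB by (simp add: app_pw app_scal)
  qed
  show "app F (emb B (par_proj (shift_par (card B) par) b x)) B'
      - par_proj (shift_par (card B') par) (if ev then b else \<not> b) (app F (emb B x) B') \<in> NB" for b
  proof -
    have shift: "par_proj (shift_par (card C) par) c y = par_proj par (c \<noteq> odd (card C)) y"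
      for C :: "nat set" and c and y :: "'i \<Rightarrow> 'r"
      by (auto simp: par_proj_def shift_par_def fun_eq_iff)
    have "emb B (par_proj (shift_par (card B) par) b x) = app (Rop b) (emb B x)"
      unfolding shift by (rule ext) (auto simp: emb_def app_Rop deg par_proj_zero)
    then have "app F (emb B (par_proj (shift_par (card B) par) b x)) = app (F * Rop b) (emb B x)"
      by simp
    also have "\<dots> = app (Rop (b = ev) * F) (emb B x)"
      using F by (simp add: graded_def)
    finally show ?thesis
      unfolding shift using NB by (auto simp: app_Rop deg)
  qed
  fix y :: "'i \<Rightarrow> 'r"
  assume y: "y \<in> vecs I"
  show "app F (emb B (x + y)) B' - (app F (emb B x) B' + app F (emb B y) B') \<in> NB"
    using NB by (simp add: emb_add)
  assume "x - y \<in> NA"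
  moreover have "x - y \<in> vecs I"
    using x y by (simp add: vecs_def)
  ultimately show "app F (emb B x) B' - app F (emb B y) B' \<in> NB"
    using NA[of "x - y"] by (simp add: emb_diff)
qed

section \<open>The morphisms psi and theta\<close>

text \<open>The chain map \<open>A * P\<close> lifts a class in \<open>X/tX\<close> to
  \<open>\<Omega> \<otimes> X\<close>; the top coefficient then lies in \<open>X[n]\<close>.\<close>

definition psi :: "('i \<Rightarrow> 'r) \<Rightarrow> 'i \<Rightarrow> 'r" where
  "psi x = app (hp.A * hp.P) (emb {} x) {..<n}"

lemma mat_app_sign: "mat_app I M ((- 1) ^ k * x) = (- 1) ^ k * mat_app I M x"
  using app_minus_one_power[of "mat I M" k x] by (simp add: app_mat)

lemma mat_app_minus: "mat_app I M (- x) = - mat_app I M x"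
  using app_minus[of "mat I M" x] by (simp only: app_mat)

text \<open>Contraction never produces a top form, so taking the top coefficient turns
  \<open>T\<close> into the differential of \<open>X[n]\<close>.\<close>

lemma app_delta_top: "app delta y {..<n} = 0"
  by (simp add: delta_def app_sum_left sum_fun app_pw app_an)

lemma app_Dop_top: "app Dop y {..<n} = (- 1) ^ n * mat_app I D (y {..<n})"
  by (simp add: Dop_def app_pw app_eps app_mat mat_app_sign)

lemma app_Dop_emb: "app Dop (emb B x) = emb B ((- 1) ^ deg B * mat_app I D x)"
  by (simp add: Dop_def app_eps_emb app_pw_emb app_mat mat_app_sign deg_def)

lemma mat_app_shift: "mat_app I (shift_mat n D) x = (- 1) ^ n * mat_app I D x"
  by (cases "even n") (auto simp: mat_app_def shift_mat_def fun_eq_iff simp flip: sum_negf)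

text \<open>A vector with entries in \<open>tR\<close> is \<open>delta\<close> of a 1-form, and
  \<open>P\<close> kills the image of \<open>delta\<close>.\<close>

lemma psi_tvecs:
  assumes "x \<in> tvecs I t n"
  shows "psi x = 0"
proof -
  have "\<forall>i. \<exists>c. x i = (\<Sum>j<n. t j * c j)"
    using assms by (simp add: tvecs_def tideal_def)
  then obtain c where c: "\<And>i. x i = (\<Sum>j<n. t j * c i j)"
    by metis
  define v where "v j = (\<lambda>i. c i j)" for j
  have an_emb: "app (an j) (emb {} v) = 0" for j and v :: "'i \<Rightarrow> 'r"
    by (rule ext) (simp add: app_an emb_def)
  have "app delta (app (cr j) (emb {} (v j))) = emb {} (\<lambda>i. t j * v j i)" if "j < n" for j
  proof -
    have "app (an k) (app (cr j) (emb {} (v j))) = (if k = j then emb {} (v j) else 0)" for k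
      using arg_cong[OF an_cr[of k j], of "\<lambda>f. app f (emb {} (v j))"] by (simp add: an_emb)
    then have "app delta (app (cr j) (emb {} (v j)))
        = (\<Sum>k<n. if k = j then app (pw (scal (t k))) (emb {} (v j)) else 0)"
      unfolding delta_def app_sum_left by (intro sum.cong refl) simp
    then show ?thesis
      using that by (simp add: app_pw_emb app_scal)
  qed
  then have "app delta (\<Sum>j<n. app (cr j) (emb {} (v j))) = emb {} (\<Sum>j<n. (\<lambda>i. t j * v j i))"
    by (simp add: app_sum emb_sum)
  also have "(\<Sum>j<n. (\<lambda>i. t j * v j i)) = x"
    by (rule ext) (simp add: sum_fun c v_def)
  finally have "app hp.P (emb {} x) = app (hp.P * delta) (\<Sum>j<n. app (cr j) (emb {} (v j)))"
    by simp
  then show ?thesis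
    by (simp only: hp.P_delta psi_def app_arith) (simp add: psi_def)
qed

lemma lf_morphism_psi:
  "lf_morphism phi I (tvecs I t n) par D {0} (shift_par n par) (shift_mat n D) psi"
  unfolding lf_morphism_def
proof (intro conjI ballI)
  have "graded True (hp.A * hp.P)"
    using graded_mult[OF graded_A graded_P] by simp
  then have "lf_map phi I True (tvecs I t n) (shift_par (card ({} :: nat set)) par) {0} (shift_par (card {..<n}) par)
      (\<lambda>x. app (hp.A * hp.P) (emb {} x) {..<n})"
    by (rule lf_map_block) (use psi_tvecs in \<open>simp_all add: psi_def\<close>)
  then show "lf_map phi I True (tvecs I t n) par {0} (shift_par n par) psi"
    by (simp add: shift_par_def psi_def[abs_def])
  fix x :: "'i \<Rightarrow> 'r"
  have "psi (mat_app I D x) = app (hp.A * hp.P * Dop) (emb {} x) {..<n}"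
    by (simp add: psi_def app_Dop_emb deg_def)
  also have "\<dots> = app (hp.T * (hp.A * hp.P)) (emb {} x) {..<n}"
    by (simp only: hp.chain_map)
  also have "\<dots> = (- 1) ^ n * mat_app I D (psi x)"
    by (simp add: hp.T_def app_Dop_top app_delta_top psi_def)
  finally show "psi (mat_app I D x) - mat_app I (shift_mat n D) (psi x) \<in> {0}"
    by (simp add: mat_app_shift)
qed

section \<open>The twist by the null-homotopies, and the morphism \<open>theta\<close>\<close>

definition "vdel j = pw (scal (t j) * cut I) * an j"
definition "U j = lam j * an j"
definition "G = prod_list (map (\<lambda>j. 1 - U j) [0..<n])"

text \<open>By \<open>T_G\<close>, \<open>G\<close> maps the top forms \<open>X[n]\<close> into
  \<open>\<Omega> \<otimes> X\<close> compatibly with \<open>T\<close>; the coefficient in degree 0,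
  taken modulo \<open>t\<close>, lands in \<open>X/tX\<close>.\<close>

definition theta :: "('i \<Rightarrow> 'r) \<Rightarrow> 'i \<Rightarrow> 'r" where
  "theta x = app G (emb {..<n} x) {}"

lemma graded_U: "j < n \<Longrightarrow> graded True (U j)"
  unfolding U_def using graded_mult[OF graded_lam graded_an] by simp

lemma graded_G: "graded True G"
  unfolding G_def by (intro graded_prod_list graded_diff graded_one graded_U) simp

lemma an_lam: "j < n \<Longrightarrow> an j * lam i = - (lam i * an j)"
  by (simp add: lam_def mult.assoc mult_left_assoc[OF an_pw] eps_an)

lemma an_Dop: "j < n \<Longrightarrow> an j * Dop = - (Dop * an j)"
  by (simp add: Dop_def mult.assoc mult_left_assoc[OF an_pw] eps_an)

lemma Dop_lam:
  assumes "j < n"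
  shows "Dop * lam j + lam j * Dop = pw (scal (t j) * cut I)"
proof -
  have "mat I (L j) * mat I D + mat I D * mat I (L j) = scal (t j) * cut I"
    unfolding mat_mat[OF finite_I] mat_add using L assms finite_I
    by (intro mat_diagonal) (simp_all add: sum.distrib)
  moreover have "Dop * lam j + lam j * Dop = pw (mat I (L j) * mat I D + mat I D * mat I (L j))"
    by (simp add: Dop_def lam_def mult.assoc mult_left_assoc[OF eps_pw] eps_sq pw_hom)
  ultimately show ?thesis
    by simp
qed

text \<open>The commutator of \<open>Dop\<close> and \<open>U j\<close> is \<open>vdel j\<close>
  because \<open>lam j\<close> is a null-homotopy of \<open>t j\<close>, and
  \<open>vdel j * U j = 0\<close> because \<open>an j\<close> squares to zero.\<close>

lemma twist_step:
  assumes "j < n"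
  shows "(Dop + vdel j) * (1 - U j) = (1 - U j) * Dop"
proof -
  have "U j * Dop = - (lam j * Dop * an j)"
    using assms by (simp add: U_def mult.assoc an_Dop)
  then have "Dop * U j - U j * Dop = vdel j"
    unfolding vdel_def Dop_lam[OF assms, symmetric] by (simp add: U_def distrib_right mult.assoc)
  moreover have "vdel j * U j = 0"
    using assms by (simp add: vdel_def U_def mult.assoc mult_left_assoc[OF an_lam] an_sq)
  ultimately show ?thesis
    by (simp add: distrib_right left_diff_distrib right_diff_distrib) (simp add: algebra_simps)
qed

lemma vdel_U:
  assumes "j < n" "k < n"
  shows "vdel k * U j = U j * vdel k"
proof -
  have lam_pw: "lam j * pw (scal (t k) * cut I) = pw (scal (t k) * cut I) * lam j"
  proof -
    have "mat I (L j) * (scal (t k) * cut I) = scal (t k) * cut I * mat I (L j)"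
      by (simp add: mult.assoc mat_cut mat_scal mult_left_assoc[OF mat_scal])
    then have "pw (mat I (L j)) * pw (scal (t k) * cut I) = pw (scal (t k) * cut I) * pw (mat I (L j))"
      by (simp only: pw_hom(6)[symmetric])
    note comm = this
    show ?thesis
      by (simp only: lam_def mult.assoc eps_pw mult_left_assoc[OF comm])
  qed
  have an_U: "an k * U j = U j * an k"
    using assms by (simp add: U_def mult_left_assoc[OF an_lam] mult.assoc an_an[of k j])
  show ?thesis
    by (simp only: vdel_def mult.assoc an_U)
      (simp only: U_def mult.assoc mult_left_assoc[OF lam_pw] mult_left_assoc[OF an_pw])
qed

text \<open>The summands of \<open>delta\<close> are absorbed one at a time: \<open>vdel m\<close>
  commutes with the earlier factors and is removed by \<open>1 - U m\<close>.\<close>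

lemma twist:
  assumes "m \<le> n"
  shows "(Dop + (\<Sum>j<m. vdel j)) * prod_list (map (\<lambda>j. 1 - U j) [0..<m])
    = prod_list (map (\<lambda>j. 1 - U j) [0..<m]) * Dop"
  using assms
proof (induction m)
  case (Suc m)
  let ?G = "prod_list (map (\<lambda>j. 1 - U j) [0..<m])"
  have "vdel m * prod_list (map (\<lambda>j. 1 - U j) js) = prod_list (map (\<lambda>j. 1 - U j) js) * vdel m"
    if "set js \<subseteq> {..<n}" for js
    using that
  proof (induction js)
    case (Cons j js)
    have "vdel m * (1 - U j) = (1 - U j) * vdel m"
      using vdel_U[of j m] Cons.prems Suc.prems by (simp add: left_diff_distrib right_diff_distrib)
    note comm = this
    show ?case
      using Cons by (simp add: mult.assoc mult_left_assoc[OF comm])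
  qed simp
  then have comm: "vdel m * ?G = ?G * vdel m"
    using Suc.prems by (simp add: subset_iff)
  have "(Dop + (\<Sum>j<Suc m. vdel j)) * (?G * (1 - U m))
      = ((Dop + (\<Sum>j<m. vdel j)) * ?G + vdel m * ?G) * (1 - U m)"
    by (simp only: sum.lessThan_Suc distrib_right mult.assoc add.assoc)
  also have "\<dots> = ?G * ((Dop + vdel m) * (1 - U m))"
    using Suc by (simp only: comm Suc_leD) (simp only: distrib_left distrib_right mult.assoc)
  also have "\<dots> = ?G * (1 - U m) * Dop"
    using Suc.prems by (simp only: twist_step Suc_le_eq mult.assoc)
  finally show ?case
    by simp
qed simp

lemma T_G:
  assumes "x \<in> vecs I"
  shows "app hp.T (app G (emb {..<n} x)) = app G (emb {..<n} (mat_app I (shift_mat n D) x))"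
proof -
  let ?g = "app G (emb {..<n} x)"
  have "?g = app (G * pw (cut I)) (emb {..<n} x)"
    using assms by (simp add: app_pw_emb cut_vecs)
  also have "\<dots> = app (pw (cut I)) ?g"
    using graded_G by (simp add: graded_def)
  finally have cut: "app (pw (cut I)) ?g = ?g" ..
  \<comment> \<open>On vectors supported on \<open>I\<close>, \<open>delta\<close> agrees with the
    sum of the cut operators \<open>vdel j\<close>.\<close>
  have "app delta ?g = app (delta * pw (cut I)) ?g"
    by (simp add: cut)
  also have "\<dots> = app (\<Sum>j<n. vdel j) ?g"
    by (simp add: delta_def vdel_def sum_distrib_right mult.assoc an_pw pw_hom)
  finally have "app hp.T ?g = app ((Dop + (\<Sum>j<n. vdel j)) * G) (emb {..<n} x)"
    by (simp add: hp.T_def)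
  also have "\<dots> = app (G * Dop) (emb {..<n} x)"
    using twist[of n] by (simp add: G_def)
  finally show ?thesis
    by (simp add: app_Dop_emb mat_app_shift deg_def)
qed

lemma lf_morphism_theta:
  "lf_morphism phi I {0} (shift_par n par) (shift_mat n D) (tvecs I t n) par D theta"
  unfolding lf_morphism_def
proof (intro conjI ballI)
  have "lf_map phi I True {0} (shift_par (card {..<n}) par) (tvecs I t n) (shift_par (card ({} :: nat set)) par)
      (\<lambda>x. app G (emb {..<n} x) {})"
    using graded_G
  proof (rule lf_map_block)
    fix z :: "'i \<Rightarrow> 'r"
    assume "z \<in> {0}"
    then have "emb {..<n} z = 0"
      by (auto simp: emb_def)
    then show "app G (emb {..<n} z) {} \<in> tvecs I t n"
      by (simp add: zero_in_tvecs)
  qed (simp_all add: zero_in_tvecs)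
  then show lf: "lf_map phi I True {0} (shift_par n par) (tvecs I t n) par theta"
    by (simp add: shift_par_def theta_def[abs_def])
  fix x :: "'i \<Rightarrow> 'r"
  assume x: "x \<in> vecs I"
  have shift: "mat_app I (shift_mat n D) x \<in> vecs I"
    by (simp add: mat_app_def vecs_def)
  let ?g = "app G (emb {..<n} x)"
  have "theta (mat_app I (shift_mat n D) x) = app hp.T ?g {}"
    using T_G[OF x] by (simp add: theta_def)
  also have "\<dots> = mat_app I D (theta x) + app delta ?g {}"
    by (simp only: hp.T_def app_arith plus_fun_apply) (simp add: Dop_def app_pw app_eps app_mat theta_def)
  \<comment> \<open>The defect is a degree-0 value of \<open>delta\<close>, hence in
    \<open>tX\<close>: \<open>theta\<close> respects the differentials only modulo
    \<open>t\<close>.\<close>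
  finally have eq: "theta (mat_app I (shift_mat n D) x) - mat_app I D (theta x) = app delta ?g {}"
    by simp
  have "mat_app I D (theta x) \<in> vecs I" "theta (mat_app I (shift_mat n D) x) \<in> vecs I"
    using lf shift by (simp_all add: lf_map_def mat_app_def vecs_def)
  then have "app delta ?g {} \<in> vecs I"
    unfolding eq[symmetric] by (simp add: vecs_def)
  moreover have "app delta ?g {} i \<in> tideal t n" for i
    using tidealI[of t "\<lambda>j. app (an j) ?g {} i" n]
    by (simp add: delta_def app_sum_left sum_fun app_pw app_scal)
  ultimately show "theta (mat_app I (shift_mat n D) x) - mat_app I D (theta x) \<in> tvecs I t n"
    unfolding eq by (simp add: tvecs_def)
qed

lemma app_G_top: "app G y {..<n} = y {..<n}"
proof -
  have "app (prod_list (map (\<lambda>j. 1 - U j) js)) y {..<n} = y {..<n}" if "set js \<subseteq> {..<n}" for js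
    using that by (induction js) (simp_all add: U_def lam_def app_pw app_eps app_an)
  then show ?thesis
    by (simp add: G_def subset_iff)
qed

lemma app_one_minus_U:
  "app (1 - U j) z A = z A - app (mat I (L j)) ((- 1) ^ deg A * (if j \<in> A then 0 else ksgn j A * z (insert j A)))"
  by (simp add: U_def lam_def app_pw app_eps_deg app_an)

text \<open>The coefficient of \<open>(1 - U j) z\<close> at \<open>A\<close> involves only those of
  \<open>z\<close> at \<open>A\<close> and \<open>insert j A\<close>, so vanishing on a family
  closed under these insertions persists.\<close>

lemma app_twist_eq_0:
  assumes "\<And>A. A \<in> F \<Longrightarrow> y A = 0" "\<And>A j. A \<in> F \<Longrightarrow> j \<in> set js \<Longrightarrow> insert j A \<in> F" "A \<in> F"
  shows "app (prod_list (map (\<lambda>j. 1 - U j) js)) y A = 0"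
  using assms(2,3)
proof (induction js arbitrary: A)
  case (Cons j js)
  let ?z = "app (prod_list (map (\<lambda>j. 1 - U j) js)) y"
  have "?z A = 0" "?z (insert j A) = 0"
    using Cons.prems by (auto intro!: Cons.IH)
  then show ?case
    by (simp only: list.map prod_list.Cons app_arith(6) app_one_minus_U mult_zero_right app_zero diff_zero if_cancel)
qed (simp add: assms(1))

text \<open>\<open>P\<close> sees only degree 0, so \<open>psi (theta x)\<close> is the top
  coefficient of \<open>A * P\<close> applied to the full twisted form. By \<open>homotopy\<close>
  this differs from \<open>x\<close> by an anticommutator with \<open>T\<close>, and
  \<open>T_G\<close> turns it into a null-homotopy given by the top block of
  \<open>- (A * H * G)\<close>.\<close>

lemma lf_homotopic_psi_theta:
  "lf_homotopic phi I {0} (shift_par n par) (shift_mat n D) {0} (shift_par n par) (shift_mat n D) (psi \<circ> theta) id"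
  unfolding lf_homotopic_def
proof (intro exI[of _ "\<lambda>x. app (- (hp.A * hp.H * G)) (emb {..<n} x) {..<n}"] conjI ballI)
  have "graded False (- (hp.A * hp.H * G))"
    using graded_minus[OF graded_mult[OF graded_mult[OF graded_A graded_H] graded_G]] by simp
  then have "lf_map phi I False {0} (shift_par (card {..<n}) par) {0} (shift_par (card {..<n}) par)
      (\<lambda>x. app (- (hp.A * hp.H * G)) (emb {..<n} x) {..<n})"
  proof (rule lf_map_block)
    fix z :: "'i \<Rightarrow> 'r"
    assume "z \<in> {0}"
    then have "emb {..<n} z = 0"
      by (auto simp: emb_def)
    then show "app (- (hp.A * hp.H * G)) (emb {..<n} z) {..<n} \<in> {0}"
      by simp
  qed simp_all
  then show "lf_map phi I False {0} (shift_par n par) {0} (shift_par n par)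
      (\<lambda>x. app (- (hp.A * hp.H * G)) (emb {..<n} x) {..<n})"
    by simp
  fix x :: "'i \<Rightarrow> 'r"
  assume x: "x \<in> vecs I"
  let ?g = "app G (emb {..<n} x)"
  have "app Z ?g = emb {} (theta x)"
  proof
    fix A
    \<comment> \<open>Nonempty index sets disjoint from \<open>{..<n}\<close> also have degree 0;
      the twist never reaches them.\<close>
    have "?g A = 0" if "\<not> A \<subseteq> {..<n}"
      unfolding G_def using that
      by (intro app_twist_eq_0[of "{A. \<not> A \<subseteq> {..<n}}"]) (auto simp: emb_def)
    then show "app Z ?g A = emb {} (theta x) A"
      by (cases "A = {}") (auto simp: app_Z emb_def theta_def deg_eq_0)
  qed
  then have "psi (theta x) = app (hp.A * (hp.P * Z)) ?g {..<n}"
    by (simp add: psi_def)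
  also have "\<dots> = app (1 - (hp.T * (hp.A * hp.H) + hp.A * hp.H * hp.T)) ?g {..<n}"
    by (simp add: hp.homotopy hp.P_Z)
  also have "\<dots> = x - ((- 1) ^ n * mat_app I D (app (hp.A * hp.H * G) (emb {..<n} x) {..<n})
      + app (hp.A * hp.H) (app hp.T ?g) {..<n})"
    by (simp add: hp.T_def app_Dop_top app_delta_top app_G_top) (simp add: emb_def)
  finally show "(psi \<circ> theta) x - id x - (mat_app I (shift_mat n D) (app (- (hp.A * hp.H * G)) (emb {..<n} x) {..<n})
      + app (- (hp.A * hp.H * G)) (emb {..<n} (mat_app I (shift_mat n D) x)) {..<n}) \<in> {0}"
    unfolding T_G[OF x] by (simp add: mat_app_shift mat_app_minus)
qed

section \<open>The idempotent modulo t\<close>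

definition "a j = mat I D * cw (del j) - cw (del j) * mat I D"
text \<open>The Atiyah class acting on all of \<open>\<Omega> \<otimes> X\<close>, by
  \<open>C_eq\<close> and \<open>app_a\<close>.\<close>

definition "C = - (nabla * Dop + Dop * nabla)"

lemma C_eq: "C = (\<Sum>j<n. pw (a j) * (cr j * eps n))"
proof -
  have "pw (cw (del j)) * cr j * Dop + Dop * (pw (cw (del j)) * cr j) = - (pw (a j) * (cr j * eps n))"
    if "j < n" for j
    using that
    by (simp add: Dop_def a_def pw_hom mult.assoc mult_left_assoc[OF cr_pw] mult_left_assoc[OF eps_pw] eps_cr)
      (simp add: algebra_simps)
  then show ?thesis
    by (simp add: C_def nabla_def sum_distrib_left sum_distrib_right flip: sum.distrib sum_negf)
qed

lemma app_a: "j < n \<Longrightarrow> app (a j) = atiyah_comp I D del j"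
  by (rule ext) (simp add: a_def atiyah_comp_def app_mat app_cw del_additive)

lemma C_power:
  "C ^ m = (\<Sum>js | set js \<subseteq> {..<n} \<and> length js = m.
    (- 1) ^ (m choose 2) * pw (prod_list (map a js)) * prod_list (map cr js)) * eps n ^ m"
proof -
  have comm: "prod_list (map (\<lambda>j. pw (a j) * (cr j * eps n)) js)
      = pw (prod_list (map a js)) * prod_list (map (\<lambda>j. cr j * eps n) js)" for js
  proof (induction js)
    case (Cons j js)
    then show ?case
      by (simp add: pw_hom mult.assoc mult_left_assoc[OF eps_pw] mult_left_assoc[OF cr_pw])
  qed (simp add: pw_hom)
  show ?thesis
    unfolding C_eq sum_power_lists[OF finite_lessThan] sum_distrib_right
  proof (rule sum.cong[OF refl])
    fix js
    assume "js \<in> {js. set js \<subseteq> {..<n} \<and> length js = m}"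
    then show "prod_list (map (\<lambda>j. pw (a j) * (cr j * eps n)) js)
        = (- 1) ^ (m choose 2) * pw (prod_list (map a js)) * prod_list (map cr js) * eps n ^ m"
      unfolding comm by (cases "even (m choose 2)") (auto simp: mult.assoc prod_list_cr_eps)
  qed
qed

text \<open>\<open>eps n\<close> fixes 0-forms, and only permutations survive among the words in
  \<open>cr\<close>; their signs assemble \<open>atiyah_pow\<close>. The sign left over comes from
  collecting the \<open>eps n\<close> in \<open>C_power\<close>.\<close>

lemma app_C_power_top:
  "app (C ^ n) (emb {} x) {..<n} = (- 1) ^ (n choose 2) * atiyah_pow I D del n x"
proof -
  have coeff: "app ((- 1) ^ c * pw f) (of_int (sign \<sigma>) * emb {..<n} x) {..<n}
      = (- 1) ^ c * (of_int (sign \<sigma>) * app f x)" for c f and \<sigma> :: "nat \<Rightarrow> nat"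
    by (cases \<sigma> rule: sign_cases; cases "even c") (simp_all add: app_pw emb_def)
  have eps: "app (eps n ^ k) (emb {} x) = emb {} x" for k
    by (induction k) (simp_all add: app_eps_emb)
  have eq: "app (C ^ n) (emb {} x) = (\<Sum>\<sigma> | \<sigma> permutes {..<n}.
      app ((- 1) ^ (n choose 2) * pw (prod_list (map a (map \<sigma> [0..<n]))))
        (of_int (sign \<sigma>) * emb {..<n} x))"
    unfolding C_power app_arith(6) eps sum_lists_anticommute[OF cr_cr cr_sq] app_sum_left app_of_int_sign
    using app_cr_list_emb[of 0 n x] by (simp add: atLeast0LessThan)
  have "app (C ^ n) (emb {} x) {..<n} = (\<Sum>\<sigma> | \<sigma> permutes {..<n}. (- 1) ^ (n choose 2) *
      (of_int (sign \<sigma>) * app (prod_list (map a (map \<sigma> [0..<n]))) x))"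
    unfolding eq sum_fun[of _ _ "{..<n}"] coeff ..
  also have "\<dots> = (- 1) ^ (n choose 2) * atiyah_pow I D del n x"
    unfolding atiyah_pow_def sum_distrib_left
  proof (rule sum.cong[OF refl])
    fix \<sigma>
    assume "\<sigma> \<in> {\<sigma>. \<sigma> permutes {..<n}}"
    then have maps: "map (\<lambda>k. app (a (\<sigma> k))) [0..<n] = map (\<lambda>k. atiyah_comp I D del (\<sigma> k)) [0..<n]"
      using permutes_in_image[of \<sigma> "{..<n}"] by (simp add: app_a)
    have "app (prod_list (map a (map \<sigma> [0..<n]))) x = comp_list (map (\<lambda>k. atiyah_comp I D del (\<sigma> k)) [0..<n]) x"
      using app_prod_list[of "\<lambda>k. a (\<sigma> k)" "[0..<n]" x] by (simp only: maps map_map comp_def)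
    then show "(- 1) ^ (n choose 2) * (of_int (sign \<sigma>) * app (prod_list (map a (map \<sigma> [0..<n]))) x)
      = (- 1) ^ (n choose 2) * (\<lambda>i. of_int (sign \<sigma>) * comp_list (map (\<lambda>k. atiyah_comp I D del (\<sigma> k)) [0..<n]) x i)"
      by (cases \<sigma> rule: sign_cases) (simp_all add: fun_eq_iff)
  qed
  finally show ?thesis .
qed

section \<open>Congruences modulo \<open>t\<close>\<close>

definition small :: "(nat set \<Rightarrow> 'i \<Rightarrow> 'r) \<Rightarrow> bool" where
  "small y \<longleftrightarrow> (\<forall>A i. y A i \<in> tideal t n)"

lemma small_add: "small y \<Longrightarrow> small z \<Longrightarrow> small (y + z)"
  by (simp add: small_def tideal_add)

lemma small_sum: "(\<And>k. k \<in> S \<Longrightarrow> small (f k)) \<Longrightarrow> small (sum f S)"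
  by (simp add: small_def sum_fun tideal_sum)

text \<open>The Leibniz terms of the two products in \<open>a j\<close> cancel because
  \<open>mat I D\<close> is \<open>R\<close>-linear.\<close>

lemma a_scal:
  assumes "j < n" "k < n"
  shows "a j * scal (t k) = scal (t k) * a j"
  using assms
  by (simp add: a_def left_diff_distrib right_diff_distrib mult.assoc cw_scal mat_scal distrib_left)
    (simp add: mult_left_assoc[OF mat_scal] mult_left_assoc[OF cw_scal] mult.assoc distrib_right)

lemma linear_tideal:
  fixes f :: "('i \<Rightarrow> 'r) endo"
  assumes "\<And>k. k < n \<Longrightarrow> f * scal (t k) = scal (t k) * f" "\<And>i. x i \<in> tideal t n"
  shows "app f x i \<in> tideal t n"
proof -
  have "\<forall>i. \<exists>c. x i = (\<Sum>j<n. t j * c j)"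
    using assms(2) by (simp add: tideal_def)
  then obtain c where c: "\<And>i. x i = (\<Sum>j<n. t j * c i j)"
    by metis
  have "x = (\<Sum>j<n. app (scal (t j)) (\<lambda>i. c i j))"
    by (rule ext) (simp add: sum_fun app_scal c)
  then have "app f x = (\<Sum>j<n. app (f * scal (t j)) (\<lambda>i. c i j))"
    by (simp add: app_sum)
  also have "\<dots> = (\<Sum>j<n. app (scal (t j)) (app f (\<lambda>i. c i j)))"
    using assms(1) by (intro sum.cong) simp_all
  finally show ?thesis
    by (simp add: sum_fun app_scal tidealI)
qed

lemma small_C:
  assumes "small y"
  shows "small (app C y)"
proof -
  have "small (app (cr j * eps n) y)" for j
  proof -
    show ?thesis
      using assms by (auto simp: small_def app_cr app_eps tideal_zero intro!: tideal_mult)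
  qed
  then have "small (app (pw (a j) * (cr j * eps n)) y)" if "j < n" for j
    using linear_tideal[of "a j"] a_scal[OF that] by (simp add: small_def app_pw)
  then show ?thesis
    unfolding C_eq app_sum_left by (intro small_sum) simp
qed

lemma supp_power: "supp {k} (app ((K * C) ^ k * hp.P) y)"
proof (induction k)
  case 0
  then show ?case
    by (auto simp: hp.P_def supp_def app_Z)
next
  case (Suc k)
  have "supp {Suc k} (app C (app ((K * C) ^ k * hp.P) y))"
    using supp_nabla[OF supp_Dop[OF Suc]] supp_Dop[OF supp_nabla[OF Suc]]
    unfolding C_def by (auto simp: supp_def)
  then show ?case
    by (simp add: supp_K)
qed

text \<open>Modulo \<open>t\<close>, \<open>K\<close> divides by the degree, and the k-th step
  arrives in degree \<open>k\<close>; the denominators multiply to \<open>fact k\<close>. Linearity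
  of \<open>C\<close> (\<open>small_C\<close>) carries the congruence through each step.\<close>

lemma small_factorial:
  "small (of_nat (fact k) * app ((K * C) ^ k * hp.P) (emb {} x) - app (C ^ k) (emb {} x))"
proof (induction k)
  case 0
  \<comment> \<open>In degree 0, \<open>1 - P\<close> is \<open>delta * K * nabla\<close>, whose
    values have coefficients in \<open>tR\<close>.\<close>
  have "app hp.P (emb {} x) A i - emb {} x A i \<in> tideal t n" for A i
  proof (cases "deg A = 0")
    case True
    have "app hp.P (emb {} x) A i - emb {} x A i = - app delta (app (K * nabla) (emb {} x)) A i"
      using True by (simp add: hp.P_def app_Z mult.assoc)
    moreover have "app delta z A i \<in> tideal t n" for z
      using tidealI[of t "\<lambda>j. app (an j) z A i" n]
      by (simp add: delta_def app_sum_left sum_fun app_pw app_scal)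
    ultimately show ?thesis
      by (simp add: tideal_minus)
  next
    case False
    then have "A \<noteq> {}"
      by (auto simp: deg_def)
    then show ?thesis
      using False by (simp add: hp.P_def app_Z emb_def tideal_zero)
  qed
  then show ?case
    by (simp add: small_def)
next
  case (Suc k)
  define y where "y = app ((K * C) ^ k * hp.P) (emb {} x)"
  define z where "z = app C y"
  have y: "supp {k} y"
    unfolding y_def by (rule supp_power)
  have z: "z A = 0" if "deg A \<noteq> Suc k" for A
    using that supp_nabla[OF supp_Dop[OF y]] supp_Dop[OF supp_nabla[OF y]]
    unfolding z_def C_def supp_def by auto
  \<comment> \<open>\<open>z\<close> lives in degree \<open>Suc k\<close>, where \<open>K\<close>
    inverts \<open>Suc k\<close> plus the Euler operator, and the latter has values in
    \<open>tR\<close>.\<close>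
  have "of_nat (Suc k) * app K z A i - z A i \<in> tideal t n" for A i
  proof (cases "deg A = Suc k")
    case True
    have "of_nat (Suc k) * Kinv (Suc k) (z A i) - z A i = - euler (Kinv (Suc k) (z A i))"
      using Kinv_right[of "Suc k" "z A i"] by (simp add: algebra_simps)
    then show ?thesis
      using True by (simp add: app_K tideal_minus euler_tideal)
  next
    case False
    then show ?thesis
      by (simp add: app_K z Kinv_zero tideal_zero)
  qed
  then have "small (of_nat (Suc k) * app K z - z)"
    by (simp add: small_def)
  then have "small (of_nat (fact k) * (of_nat (Suc k) * app K z - z))"
    by (simp add: small_def tideal_mult)
  moreover have "small (app C (of_nat (fact k) * y - app (C ^ k) (emb {} x)))"
    using Suc unfolding y_def by (rule small_C)
  ultimately have "small (of_nat (fact k) * (of_nat (Suc k) * app K z - z)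
      + app C (of_nat (fact k) * y - app (C ^ k) (emb {} x)))"
    by (rule small_add)
  also have "of_nat (fact k) * (of_nat (Suc k) * app K z - z) + app C (of_nat (fact k) * y - app (C ^ k) (emb {} x))
      = of_nat (fact (Suc k)) * app ((K * C) ^ Suc k * hp.P) (emb {} x) - app (C ^ Suc k) (emb {} x)"
    by (simp add: y_def z_def app_of_nat algebra_simps del: of_nat_fact)
  finally show ?case .
qed

text \<open>The k-th term of the Neumann series lives in degree \<open>k\<close>, so only
  \<open>k = n\<close> reaches the top form.\<close>

lemma psi_eq: "psi x = app ((K * C) ^ n * hp.P) (emb {} x) {..<n}"
proof -
  have "hp.A * hp.P = (\<Sum>k\<le>n. (K * C) ^ k * hp.P)"
    by (simp only: hp.A_def sum_distrib_right hp.perturbation_power C_def)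
  then have "psi x = (\<Sum>k\<le>n. app ((K * C) ^ k * hp.P) (emb {} x) {..<n})"
    by (simp only: psi_def app_sum_left sum_fun)
  also have "\<dots> = (\<Sum>k\<le>n. if k = n then app ((K * C) ^ n * hp.P) (emb {} x) {..<n} else 0)"
  proof (rule sum.cong[OF refl])
    fix k
    show "app ((K * C) ^ k * hp.P) (emb {} x) {..<n} = (if k = n then app ((K * C) ^ n * hp.P) (emb {} x) {..<n} else 0)"
      using supp_power[of k "emb {} x"] unfolding supp_def by (auto simp: deg_def)
  qed
  finally show ?thesis
    by simp
qed

lemma psi_atiyah: "of_nat (fact n) * psi x i - ((- 1) ^ (n choose 2) * atiyah_pow I D del n x) i \<in> tideal t n"
  using small_factorial[of n x] unfolding small_def psi_eq app_C_power_top[symmetric]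
  by (simp del: app_arith)

text \<open>To pass from the top form to degree 0 every factor \<open>1 - U j\<close> must
  contribute \<open>- U j\<close>, which gives the sign \<open>(- 1) ^ n\<close>.\<close>

lemma theta_eq: "theta x = (- 1) ^ n * app (prod_list (map (\<lambda>j. mat I (L j)) [0..<n])) x"
proof -
  have "app (prod_list (map (\<lambda>j. 1 - U j) [0..<m])) (emb {..<m} x) {}
      = (- 1) ^ m * app (prod_list (map (\<lambda>j. mat I (L j)) [0..<m])) x" if "m \<le> n" for m
    using that
  proof (induction m arbitrary: x)
    case 0
    then show ?case by (simp add: emb_def)
  next
    case (Suc m)
    let ?G = "prod_list (map (\<lambda>j. 1 - U j) [0..<m])"
    \<comment> \<open>The summand 1 of the last factor leaves \<open>m\<close> in the index set, and
      the earlier factors cannot remove it.\<close>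
    have zero: "app ?G (emb {..<Suc m} x) {} = 0"
      by (rule app_twist_eq_0[of "{A. m \<notin> A}"]) (auto simp: emb_def)
    \<comment> \<open>The sign from moving past \<open>m\<close> smaller indices cancels below
      against that of \<open>eps n\<close> in degree \<open>m\<close>.\<close>
    have "app (an m) (emb {..<Suc m} x) = emb {..<m} ((- 1) ^ m * x)"
    proof
      fix A
      have "m \<notin> A \<and> insert m A = {..<Suc m} \<longleftrightarrow> A = {..<m}"
        by (auto simp: lessThan_Suc)
      moreover have "{k \<in> {..<m}. k < m} = {..<m}"
        by auto
      ultimately show "app (an m) (emb {..<Suc m} x) A = emb {..<m} ((- 1) ^ m * x) A"
        by (auto simp: app_an emb_def ksgn_def)
    qed
    moreover have "{..<m} \<inter> {..<n} = {..<m}"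
      using Suc.prems by auto
    ultimately have "app (U m) (emb {..<Suc m} x) = emb {..<m} (app (mat I (L m)) x)"
      by (simp add: U_def lam_def app_eps_emb app_pw_emb flip: mult.assoc power_add)
    then have "app (?G * (1 - U m)) (emb {..<Suc m} x) {} = - app ?G (emb {..<m} (app (mat I (L m)) x)) {}"
      using zero by simp
    then show ?case
      using Suc.IH[of "app (mat I (L m)) x"] Suc.prems by simp
  qed
  from this[of n] show ?thesis
    by (simp add: theta_def G_def)
qed

lemma phi_nat_inv: "phi (nat_inv (fact n)) * of_nat (fact n) = 1"
proof -
  obtain u :: 's where u: "of_nat (fact n) * u = 1"
    using Q unfolding Q_algebra_def by (metis fact_gt_zero)
  have "of_nat (fact n) * (nat_inv (fact n) :: 's) = 1"
    unfolding nat_inv_def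
  proof (rule theI)
    show "of_nat (fact n) * u = 1"
      by (rule u)
    fix v :: 's
    assume "of_nat (fact n) * v = 1"
    then show "v = u"
      using u by (metis mult.left_commute mult.right_neutral)
  qed
  moreover have "phi 0 = 0"
    using phi unfolding ring_morphism_def by (metis add_cancel_right_right)
  then have "phi (of_nat k) = of_nat k" for k
    using phi by (induction k) (simp_all add: ring_morphism_def)
  ultimately show ?thesis
    using phi unfolding ring_morphism_def by (metis mult.commute)
qed

text \<open>\<open>theta\<close> is linear over \<open>R\<close> by \<open>theta_eq\<close>, so the
  congruence \<open>psi_atiyah\<close>, divided by \<open>fact n\<close>, can be carried through
  it.\<close>

lemma theta_psi: "theta (psi x) i - e_map phi I D L del n x i \<in> tideal t n"
proof -
  let ?L = "prod_list (map (\<lambda>j. mat I (L j)) [0..<n])"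
  let ?c = "phi (nat_inv (fact n))" and ?at = "atiyah_pow I D del n x"
  have comm: "prod_list (map (\<lambda>j. mat I (L j)) js) * scal r = scal r * prod_list (map (\<lambda>j. mat I (L j)) js)" for js r
    by (induction js) (simp_all add: mult.assoc mult_left_assoc[OF mat_scal])
  define d where "d = psi x - app (scal (?c * (- 1) ^ (n choose 2))) ?at"
  have "d j = ?c * (of_nat (fact n) * psi x j - ((- 1) ^ (n choose 2) * ?at) j)" for j
    using phi_nat_inv
    by (cases "even (n choose 2)") (simp_all add: d_def app_scal right_diff_distrib distrib_left flip: mult.assoc)
  then have "app ?L d i \<in> tideal t n"
    using psi_atiyah[of x] by (intro linear_tideal comm) (simp add: tideal_mult)
  then have *: "((- 1) ^ n * app ?L d) i \<in> tideal t n"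
    by (cases "even n") (simp_all add: tideal_minus)
  \<comment> \<open>Combines the sign of \<open>theta_eq\<close> with that of
    \<open>psi_atiyah\<close>.\<close>
  have "(n + 1) choose 2 = n + (n choose 2)"
    by (simp add: numeral_2_eq_2)
  moreover have "app ?L (app (scal r) y) = (\<lambda>i. r * app ?L y i)" for r y
    using arg_cong[OF comm[of "[0..<n]" r], of "\<lambda>f. app f y"] by (simp add: app_scal)
  moreover have "app ?L y = comp_list (map (\<lambda>j. mat_app I (L j)) [0..<n]) y" for y
    using app_prod_list[of "\<lambda>j. mat I (L j)" "[0..<n]" y] by (simp add: app_mat)
  ultimately have "((- 1) ^ n * app ?L d) i = theta (psi x) i - e_map phi I D L del n x i"
    by (cases "even n"; cases "even (n choose 2)") (simp_all add: theta_eq d_def e_map_def)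
  then show ?thesis
    using * by simp
qed

lemma e_map_vecs:
  assumes "x \<in> vecs I"
  shows "e_map phi I D L del n x \<in> vecs I"
proof -
  let ?L = "prod_list (map (\<lambda>j. mat I (L j)) [0..<n])" and ?at = "atiyah_pow I D del n x"
  have "graded True C"
    unfolding C_def using graded_mult[OF graded_nabla graded_Dop] graded_mult[OF graded_Dop graded_nabla]
    by (intro graded_minus graded_add) simp_all
  \<comment> \<open>Target submodule \<open>UNIV\<close> keeps only the clause about values in
    \<open>vecs I\<close>.\<close>
  then have "lf_map phi I True {0} (shift_par (card ({} :: nat set)) par) UNIV (shift_par (card {..<n}) par)
      (\<lambda>x. app (C ^ n) (emb {} x) {..<n})"
    by (intro lf_map_block graded_power) simp_all
  then have "(- 1) ^ n * ((- 1) ^ n * ?at) \<in> vecs I"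
    unfolding lf_map_def app_C_power_top using assms
    by (cases "even n"; cases "even (n choose 2)") (auto simp: vecs_def)
  then have at: "app (cut I) ?at = ?at"
    by (simp add: cut_vecs flip: mult.assoc power_add)
  have "prod_list (map (\<lambda>j. mat I (L j)) js) * cut I = cut I * prod_list (map (\<lambda>j. mat I (L j)) js)" for js
    by (induction js) (simp_all add: mult.assoc mult_left_assoc[OF mat_cut(1)] mult_left_assoc[OF mat_cut(2)])
  from arg_cong[OF this[of "[0..<n]"], of "\<lambda>f. app f ?at"]
  have "app ?L ?at \<in> vecs I"
    using cut_in_vecs[of I "app ?L ?at"] at by simp
  then show ?thesis
    using app_prod_list[of "\<lambda>j. mat I (L j)" "[0..<n]" ?at]
    by (simp add: vecs_def e_map_def app_mat)
qed

text \<open>The two maps agree modulo \<open>tX\<close> on every vector, so the zero homotopy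
  suffices.\<close>

lemma lf_homotopic_theta_psi:
  "lf_homotopic phi I (tvecs I t n) par D (tvecs I t n) par D (theta \<circ> psi) (e_map phi I D L del n)"
  unfolding lf_homotopic_def
proof (intro exI[of _ "\<lambda>_. 0"] conjI ballI)
  show "lf_map phi I False (tvecs I t n) par (tvecs I t n) par (\<lambda>_. 0)"
    by (auto simp: lf_map_def tvecs_def vecs_def par_proj_def tideal_zero)
  fix x :: "'i \<Rightarrow> 'r"
  assume x: "x \<in> vecs I"
  have "theta (psi x) \<in> vecs I"
    using x lf_morphism_psi lf_morphism_theta by (simp add: lf_morphism_def lf_map_def)
  moreover have "e_map phi I D L del n x \<in> vecs I"
    using x by (rule e_map_vecs)
  ultimately have "theta (psi x) - e_map phi I D L del n x \<in> tvecs I t n"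
    using theta_psi[of x] by (simp add: tvecs_def vecs_def)
  moreover have "mat_app I D 0 = 0"
    by (simp add: mat_app_def fun_eq_iff)
  ultimately show "(theta \<circ> psi) x - e_map phi I D L del n x - (mat_app I D 0 + 0) \<in> tvecs I t n"
    by simp
qed

end

theorem theorem10p1:
  fixes phi :: "'s::comm_ring_1 \<Rightarrow> 'r::comm_ring_1"
    and W :: 's
    and I :: "'i set" and par :: "'i \<Rightarrow> bool" and D :: "'i \<Rightarrow> 'i \<Rightarrow> 'r"
    and n :: nat and t :: "nat \<Rightarrow> 'r"
    and L :: "nat \<Rightarrow> 'i \<Rightarrow> 'i \<Rightarrow> 'r"
    and del :: "nat \<Rightarrow> 'r \<Rightarrow> 'r"
  assumes "Q_algebra TYPE('s)"
    and "ring_morphism phi"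
    and "matrix_factorisation I par D (phi W)"
    and "quasi_regular t n"
    and "fg_projective_quotient phi t n"
    and "\<forall>j<n. odd_mat I par (L j)
           \<and> (\<forall>i\<in>I. \<forall>l\<in>I. (\<Sum>k\<in>I. L j i k * D k l + D i k * L j k l) = (if i = l then t j else 0))"
    and "standard_connection phi t n del"
  shows "\<exists>\<psi> \<theta>.
      lf_morphism phi I (tvecs I t n) par D {0} (shift_par n par) (shift_mat n D) \<psi>
    \<and> lf_morphism phi I {0} (shift_par n par) (shift_mat n D) (tvecs I t n) par D \<theta>
    \<and> lf_homotopic phi I {0} (shift_par n par) (shift_mat n D) {0} (shift_par n par) (shift_mat n D)
        (\<psi> \<circ> \<theta>) id
    \<and> lf_homotopic phi I (tvecs I t n) par D (tvecs I t n) par D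
        (\<theta> \<circ> \<psi>) (e_map phi I D L del n)"
proof -
  interpret koszul phi W I par D n t L del
    using assms by unfold_locales
  show ?thesis
    using lf_morphism_psi lf_morphism_theta lf_homotopic_psi_theta lf_homotopic_theta_psi by blast
qed

end
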